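(* Let $d\ge1$ and let $I_d\subset\mathbb{K}[x_{ij}\mid i=0,\dots,d,\ j=0,1,2]$ be the ideal generated by the $2\times2$ minors of the block Hankel matrix $X_{\lfloor d/2\rfloor}$. Any diagonal term order $\prec$ is delightful for $I_d$. The ideal $I_d$ is the prime ideal defining the Segre-Veronese variety $\nu_d(\mathbb{P}^1)\times\nu_2(\mathbb{P}^1)$. For every $r\ge1$, the $(r+1)\times(r+1)$ minors of $X_{\lfloor d/2\rfloor}$ form a Gröbner basis for $I_d^{\{r\}}$ with respect to $\prec$.
   Context: $\mathbb{K}$ is an algebraically closed field. For $0\le i\le d$ let $A_i=\begin{pmatrix} x_{i0} & x_{i1} \\ x_{i1} & x_{i2} \end{pmatrix}$. For $0\le k\le d$, $X_k$ is the block Hankel matrix with $k+1$ block rows and $d-k+1$ block columns whose block in position $(a,b)$ ($0\le a\le k$, $0\le b\le d-k$) is $A_{a+b}$. A diagonal term order here is any term order that selects the product of the main diagonal entries as the leading monomial of any minor of any of the matrices $X_k$ (for instance the lexicographic order with $x_{i_1j_1}\prec x_{i_2j_2}$ if $i_1>i_2$, or $i_1=i_2$ and $j_1>j_2$). The variety $\nu_d(\mathbb{P}^1)\times\nu_2(\mathbb{P}^1)\subset\mathbb{P}^{3(d+1)-1}$ is the Segre product of the $d$-uple and $2$-uple Veronese embeddings of $\mathbb{P}^1$; its ideal is the toric ideal that is the kernel of $\mathbb{K}[x_{ij}]\to\mathbb{K}[t,u,v]$, $x_{ij}\mapsto tu^iv^j$. Join and secant ideals: $I\ast J=\big(I(\mathbf{y})+J(\mathbf{z})+\langle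 x_a-y_a-z_a\mid a\rangle\big)\cap\mathbb{K}[\mathbf{x}]$ ($a$ running over the indices of the variables), where $I(\mathbf{y})$ is $I$ with $y_a$ substituted for $x_a$; the $r$-th secant ideal is the $r$-fold join $I^{\{r\}}=I\ast\cdots\ast I$ (so $I^{\{1\}}=I$). A term order $\prec$ is delightful for $I$ if $\mathrm{in}_\prec(I^{\{r\}})=\mathrm{in}_\prec(I)^{\{r\}}$ for all $r\ge1$. *)

theory Defs
  imports
    "HOL-Library.Poly_Mapping"
    "HOL-Computational_Algebra.Polynomial"
    "HOL-Algebra.Ideal"
    "Jordan_Normal_Form.Determinant"
    "Jordan_Normal_Form.DL_Submatrix"
begin

section \<open>Polynomials in a set of indeterminates\<close>

type_synonym 'v monomial = "'v \<Rightarrow>\<^sub>0 nat"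
type_synonym ('v, 'a) mpoly = "'v monomial \<Rightarrow>\<^sub>0 'a"

definition Var :: "'v \<Rightarrow> ('v, 'a::comm_ring_1) mpoly" where
  "Var v = Poly_Mapping.single (Poly_Mapping.single v 1) 1"

definition Const :: "'a::comm_ring_1 \<Rightarrow> ('v, 'a) mpoly" where
  "Const c = Poly_Mapping.single 0 c"

definition monomials :: "'v set \<Rightarrow> 'v monomial set" where
  "monomials V = {m. Poly_Mapping.keys m \<subseteq> V}"

definition poly_ring :: "'v set \<Rightarrow> ('v, 'a::comm_ring_1) mpoly ring" where
  "poly_ring V = \<lparr>carrier = {p. Poly_Mapping.keys p \<subseteq> monomials V},
     monoid.mult = (*), one = 1, zero = 0, add = (+)\<rparr>"

text \<open>The value of \<open>p\<close> under the map that is \<open>\<phi>\<close> on coefficients and sends each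
  indeterminate \<open>v\<close> to \<open>\<sigma> v\<close>.\<close>

definition poly_subst :: "('a \<Rightarrow> 'b) \<Rightarrow> ('v \<Rightarrow> 'b) \<Rightarrow> ('v, 'a::comm_ring_1) mpoly \<Rightarrow> 'b::comm_ring_1" where
  "poly_subst \<phi> \<sigma> p = (\<Sum>m\<in>Poly_Mapping.keys p.
     \<phi> (Poly_Mapping.lookup p m) * (\<Prod>v\<in>Poly_Mapping.keys m. \<sigma> v ^ Poly_Mapping.lookup m v))"

definition rename :: "('v \<Rightarrow> 'w) \<Rightarrow> ('v, 'a::comm_ring_1) mpoly \<Rightarrow> ('w, 'a) mpoly" where
  "rename f = poly_subst Const (\<lambda>v. Var (f v))"

lemma poly_ring_cring: "cring (poly_ring V :: ('v, 'a::comm_ring_1) mpoly ring)"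
proof -
  have zero: "0 \<in> monomials V" by (simp add: monomials_def)
  have add: "Poly_Mapping.keys (p + q) \<subseteq> monomials V"
    if "Poly_Mapping.keys p \<subseteq> monomials V" "Poly_Mapping.keys q \<subseteq> monomials V"
    for p q :: "('v, 'a) mpoly"
    using Poly_Mapping.keys_add[of p q] that by blast
  have plus: "m + n \<in> monomials V" if "m \<in> monomials V" "n \<in> monomials V" for m n
    using Poly_Mapping.keys_add[of m n] that unfolding monomials_def by blast
  have mult: "Poly_Mapping.keys (p * q) \<subseteq> monomials V"
    if "Poly_Mapping.keys p \<subseteq> monomials V" "Poly_Mapping.keys q \<subseteq> monomials V"
    for p q :: "('v, 'a) mpoly"
  proof
    fix x assume "x \<in> Poly_Mapping.keys (p * q)"
    then obtain m n where "m \<in> Poly_Mapping.keys p" "n \<in> Poly_Mapping.keys q" "x = m + n"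
      using Poly_Mapping.keys_mult[of p q] by auto
    with that plus show "x \<in> monomials V" by blast
  qed
  have neg: "\<exists>y\<in>{p. Poly_Mapping.keys p \<subseteq> monomials V}. y + p = 0"
    if "Poly_Mapping.keys p \<subseteq> monomials V" for p :: "('v, 'a) mpoly"
  proof (rule bexI)
    show "- p + p = 0" by simp
    show "- p \<in> {p. Poly_Mapping.keys p \<subseteq> monomials V}" using that
      by (auto simp: in_keys_iff)
  qed
  show ?thesis
  proof (intro cringI abelian_groupI comm_monoidI, goal_cases)
    case 6
    then show ?case using neg by (auto simp: poly_ring_def)
  qed (use zero add mult in \<open>auto simp: poly_ring_def algebra_simps\<close>)
qed


section \<open>Term orders and initial ideals\<close>

text \<open>\<open>(m, n) \<in> ord\<close> means that \<open>m\<close> is at most \<open>n\<close>.\<close>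

definition term_order :: "'v set \<Rightarrow> 'v monomial rel \<Rightarrow> bool" where
  "term_order V ord \<longleftrightarrow>
     linear_order_on (monomials V) ord \<and>
     (\<forall>m\<in>monomials V. (0, m) \<in> ord) \<and>
     (\<forall>m n. \<forall>k\<in>monomials V. (m, n) \<in> ord \<longrightarrow> (m + k, n + k) \<in> ord)"

text \<open>The leading monomial of a nonzero polynomial, as a polynomial with coefficient one.\<close>

definition initial_monomial :: "'v monomial rel \<Rightarrow> ('v, 'a::comm_ring_1) mpoly \<Rightarrow> ('v, 'a) mpoly" where
  "initial_monomial ord p = Poly_Mapping.single
     (THE m. m \<in> Poly_Mapping.keys p \<and> (\<forall>n\<in>Poly_Mapping.keys p. (n, m) \<in> ord)) 1"

definition initial_ideal ::
    "'v set \<Rightarrow> 'v monomial rel \<Rightarrow> ('v, 'a::comm_ring_1) mpoly set \<Rightarrow> ('v, 'a) mpoly set" where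
  "initial_ideal V ord I = Idl\<^bsub>poly_ring V\<^esub> {initial_monomial ord p | p. p \<in> I \<and> p \<noteq> 0}"

definition groebner_basis ::
    "'v set \<Rightarrow> 'v monomial rel \<Rightarrow> ('v, 'a::comm_ring_1) mpoly set \<Rightarrow> ('v, 'a) mpoly set \<Rightarrow> bool" where
  "groebner_basis V ord G I \<longleftrightarrow> finite G \<and> G \<subseteq> I \<and>
     Idl\<^bsub>poly_ring V\<^esub> {initial_monomial ord g | g. g \<in> G \<and> g \<noteq> 0} = initial_ideal V ord I"


section \<open>Joins and secant ideals\<close>

text \<open>Three disjoint copies of the indeterminates.\<close>

datatype 'v copy = CX 'v | CY 'v | CZ 'v

text \<open>Membership of \<open>rename CX p\<close> expresses the intersection with \<open>K[x]\<close>, where \<open>K[x]\<close> is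
  identified with its copy inside the ring in all three sets of indeterminates.\<close>

definition join_ideal ::
    "'v set \<Rightarrow> ('v, 'a::comm_ring_1) mpoly set \<Rightarrow> ('v, 'a) mpoly set \<Rightarrow> ('v, 'a) mpoly set" where
  "join_ideal V I J = {p \<in> carrier (poly_ring V).
     rename CX p \<in> Idl\<^bsub>poly_ring (CX ` V \<union> CY ` V \<union> CZ ` V)\<^esub>
       (rename CY ` I \<union> rename CZ ` J \<union> {Var (CX a) - Var (CY a) - Var (CZ a) | a. a \<in> V})}"

text \<open>The \<open>r\<close>-fold join \<open>I * (I * ... * I)\<close>; only meaningful for \<open>r \<ge> 1\<close>.\<close>

definition secant_ideal :: "'v set \<Rightarrow> nat \<Rightarrow> ('v, 'a::comm_ring_1) mpoly set \<Rightarrow> ('v, 'a) mpoly set" where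
  "secant_ideal V r I = (join_ideal V I ^^ (r - 1)) I"

definition delightful :: "'v set \<Rightarrow> 'v monomial rel \<Rightarrow> ('v, 'a::comm_ring_1) mpoly set \<Rightarrow> bool" where
  "delightful V ord I \<longleftrightarrow>
     (\<forall>r\<ge>1. initial_ideal V ord (secant_ideal V r I) = secant_ideal V r (initial_ideal V ord I))"


section \<open>Block Hankel matrices and their minors\<close>

definition minors :: "nat \<Rightarrow> 'a::comm_ring_1 mat \<Rightarrow> 'a set" where
  "minors n M = {det (submatrix M R C) | R C.
     R \<subseteq> {..<dim_row M} \<and> C \<subseteq> {..<dim_col M} \<and> card R = n \<and> card C = n}"

definition sv_vars :: "nat \<Rightarrow> (nat \<times> nat) set" where
  "sv_vars d = {0..d} \<times> {0..2}"

definition sym_block :: "nat \<Rightarrow> (nat \<times> nat, 'a::comm_ring_1) mpoly mat" where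
  "sym_block i = mat_of_rows_list 2
     [[Var (i, 0), Var (i, 1)],
      [Var (i, 1), Var (i, 2)]]"

text \<open>Row \<open>p\<close> lies in block row \<open>p div 2\<close>, at position \<open>p mod 2\<close> within the block;
  likewise for columns.\<close>

definition block_hankel :: "nat \<Rightarrow> nat \<Rightarrow> (nat \<times> nat, 'a::comm_ring_1) mpoly mat" where
  "block_hankel d k = mat (2 * (k + 1)) (2 * (d - k + 1))
     (\<lambda>(p, q). sym_block (p div 2 + q div 2) $$ (p mod 2, q mod 2))"

text \<open>The type argument fixes the coefficient ring in which the minors are formed.\<close>

definition diagonal_term_order ::
    "'a::comm_ring_1 itself \<Rightarrow> nat \<Rightarrow> (nat \<times> nat) monomial rel \<Rightarrow> bool" where
  "diagonal_term_order _ d ord \<longleftrightarrow> term_order (sv_vars d) ord \<and>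
     (\<forall>k\<le>d. \<forall>R C. let M = (block_hankel d k :: (nat \<times> nat, 'a) mpoly mat) in
        R \<subseteq> {..<dim_row M} \<longrightarrow> C \<subseteq> {..<dim_col M} \<longrightarrow> card R = card C \<longrightarrow>
        initial_monomial ord (det (submatrix M R C)) = prod_list (diag_mat (submatrix M R C)))"

definition sv_ideal :: "nat \<Rightarrow> (nat \<times> nat, 'a::comm_ring_1) mpoly set" where
  "sv_ideal d = Idl\<^bsub>poly_ring (sv_vars d)\<^esub> (minors 2 (block_hankel d (d div 2)))"


section \<open>The Segre-Veronese variety\<close>

definition veronese :: "nat \<Rightarrow> 'a::field \<Rightarrow> 'a \<Rightarrow> nat \<Rightarrow> 'a" where
  "veronese n s t i = s ^ (n - i) * t ^ i"

text \<open>All homogeneous coordinate vectors, indexed by \<open>(i, j)\<close>, of the points of the Segre product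
  of the two Veronese embeddings of the projective line.\<close>

definition segre_veronese :: "nat \<Rightarrow> (nat \<times> nat \<Rightarrow> 'a::field) set" where
  "segre_veronese d = {(\<lambda>(i, j). c * (veronese d s t i * veronese 2 u v j)) | c s t u v.
     c \<noteq> 0 \<and> (s, t) \<noteq> (0, 0) \<and> (u, v) \<noteq> (0, 0)}"

text \<open>Since the set of points is closed under nonzero scaling, over an infinite field this is the
  homogeneous ideal of the projective variety.\<close>

definition vanishing_ideal :: "'v set \<Rightarrow> ('v \<Rightarrow> 'a::field) set \<Rightarrow> ('v, 'a) mpoly set" where
  "vanishing_ideal V S = {p \<in> carrier (poly_ring V). \<forall>x\<in>S. poly_subst id x p = 0}"

datatype toric_var = TT | UU | VV

definition toric_map :: "(nat \<times> nat, 'a::comm_ring_1) mpoly \<Rightarrow> (toric_var, 'a) mpoly" where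
  "toric_map = poly_subst Const (\<lambda>(i, j). Var TT * Var UU ^ i * Var VV ^ j)"

definition toric_ideal :: "nat \<Rightarrow> (nat \<times> nat, 'a::comm_ring_1) mpoly set" where
  "toric_ideal d = {p \<in> carrier (poly_ring (sv_vars d)). toric_map p = 0}"

end

(*
The minors X[a, c | b, d] identify monomials with the same weight under x_ij -> t u^i v^j.  Order
the indeterminates by positions in the Hankel matrix: v is below w if v can stand to the upper left
of w.  Every monomial reduces modulo I_d to a standard one (whose support is an antichain), and a
standard monomial is determined by its weight.  Hence I_d is the toric ideal, with squarefree initial
ideal generated by the chains of length 2.

Splitting off one copy of the standard monomials shows that the r-th secant ideal is the kernel of
x_ij -> t_1 u_1^i v_1^j + ... + t_r u_r^i v_r^j, over any field.  It contains the minors of size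
r + 1, whose leading monomials are the chains of length r + 1.  Conversely, if the support of a
monomial m contains no such chain, Mirsky's theorem writes m as a product of r standard monomials with
disjoint supports; the coefficient of the product of their weights in the image of a polynomial with
leading monomial m is just the leading coefficient, so this polynomial is not in the kernel.  The
r-th secant ideal of the chains of length 2 is computed by the same splitting of supports.
*)
theory Submission
  imports Defs
begin

text \<open>An indeterminate occurs at several positions of the Hankel matrix, so being to the upper
  left becomes a partial order only after each one has been given a single position. Secant ideals
  are handled as kernels rather than through points: a kernel condition concerns coefficients only,
  so the argument works over every commutative coefficient ring. The obstacle is positive
  characteristic. The coefficient of a term in the image of a monomial is a product of multinomial
  coefficients and may vanish. Mirsky's theorem is therefore applied to the support of the leading
  monomial: each indeterminate goes with its full exponent to one colour, the supports are disjoint,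
  and the coefficient is 1. Reduction to standard monomials terminates by a quadratic weight that
  knows no term order, so the description of I_d is independent of the order, which enters later
  through the leading monomials of the minors. The minors used there must be shown to be nonzero
  separately, because the hypothesis on the order prescribes \<open>initial_monomial\<close> without
  excluding the zero polynomial.\<close>

abbreviation "keys \<equiv> Poly_Mapping.keys"
abbreviation "lookup \<equiv> Poly_Mapping.lookup"
abbreviation "single \<equiv> Poly_Mapping.single"
abbreviation "polys V \<equiv> carrier (poly_ring V)"


section \<open>Substitution\<close>

lemma sum_single_lookup: "p = (\<Sum>m\<in>keys p. single m (lookup p m))"
  by (rule poly_mapping_eqI)
    (auto simp: lookup_sum lookup_single when_def sum.delta in_keys_iff)

definition meval :: "('v \<Rightarrow> 'b) \<Rightarrow> 'v monomial \<Rightarrow> 'b::comm_ring_1" where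
  "meval \<sigma> m = (\<Prod>v\<in>keys m. \<sigma> v ^ lookup m v)"

lemma meval_superset:
  assumes "finite A" "keys m \<subseteq> A"
  shows "meval \<sigma> m = (\<Prod>v\<in>A. \<sigma> v ^ lookup m v)"
  unfolding meval_def using assms
  by (intro prod.mono_neutral_left) (auto simp: in_keys_iff)

lemma meval_0 [simp]: "meval \<sigma> 0 = 1"
  by (simp add: meval_def)

lemma meval_add: "meval \<sigma> (m + n) = meval \<sigma> m * meval \<sigma> n"
proof -
  let ?A = "keys m \<union> keys n"
  have "keys (m + n) \<subseteq> ?A"
    by (rule Poly_Mapping.keys_add)
  then show ?thesis
    by (simp add: meval_superset[of ?A] lookup_add power_add prod.distrib)
qed

lemma meval_single [simp]: "meval \<sigma> (single v n) = \<sigma> v ^ n"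
  by (simp add: meval_def)

lemma meval_sum: "meval \<sigma> (sum f A) = (\<Prod>a\<in>A. meval \<sigma> (f a))"
  by (induction A rule: infinite_finite_induct) (simp_all add: meval_add)

lemma meval_cong: "(\<And>v. v \<in> keys m \<Longrightarrow> \<sigma> v = \<tau> v) \<Longrightarrow> meval \<sigma> m = meval \<tau> m"
  unfolding meval_def by (intro prod.cong) auto

lemma prod_single_1: "(\<Prod>a\<in>A. single (f a) 1) = (single (sum f A) 1 :: _ \<Rightarrow>\<^sub>0 'a::comm_ring_1)"
  by (induction A rule: infinite_finite_induct) (simp_all add: mult_single)

lemma single_power_1: "(single m 1) ^ n = (single (\<Sum>_<n. m) 1 :: _ \<Rightarrow>\<^sub>0 'a::comm_ring_1)"
  by (induction n) (simp_all add: mult_single add.commute)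

lemma sum_single_nat: "(\<Sum>_<n. single v 1) = single v (n::nat)"
  by (induction n) (simp_all add: single_add[symmetric])

lemma sum_single_nat_keys: "(\<Sum>v\<in>keys m. single v (lookup m v)) = (m :: 'v monomial)"
  using sum_single_lookup[of m] by simp

lemma meval_Var [simp]: "meval Var m = (single m 1 :: ('v, 'a::comm_ring_1) mpoly)"
proof -
  have "meval Var m = (\<Prod>v\<in>keys m. single (single v (lookup m v)) (1::'a))"
    unfolding meval_def Var_def single_power_1 sum_single_nat ..
  then show ?thesis
    by (simp add: prod_single_1 sum_single_nat_keys)
qed

lemma Const_mult_single: "Const c * single m d = single m (c * d)"
  by (simp add: Const_def mult_single)

text \<open>One locale for two uses: \<open>Const\<close> gives substitutions with polynomial
  values, \<open>id\<close> gives evaluation at points.\<close>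

locale coeff_hom =
  fixes \<phi> :: "'a::comm_ring_1 \<Rightarrow> 'b::comm_ring_1"
  assumes hom_0 [simp]: "\<phi> 0 = 0"
    and hom_1 [simp]: "\<phi> 1 = 1"
    and hom_add: "\<phi> (x + y) = \<phi> x + \<phi> y"
    and hom_mult: "\<phi> (x * y) = \<phi> x * \<phi> y"
begin

lemma ps_superset:
  assumes "finite A" "keys p \<subseteq> A"
  shows "poly_subst \<phi> \<sigma> p = (\<Sum>m\<in>A. \<phi> (lookup p m) * meval \<sigma> m)"
  unfolding poly_subst_def meval_def[symmetric] using assms
  by (intro sum.mono_neutral_left) (auto simp: in_keys_iff)

lemma ps_0 [simp]: "poly_subst \<phi> \<sigma> 0 = 0"
  by (simp add: poly_subst_def)

lemma ps_single [simp]: "poly_subst \<phi> \<sigma> (single m c) = \<phi> c * meval \<sigma> m"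
  by (subst ps_superset[of "{m}"]) auto

lemma ps_add: "poly_subst \<phi> \<sigma> (p + q) = poly_subst \<phi> \<sigma> p + poly_subst \<phi> \<sigma> q"
proof -
  let ?A = "keys p \<union> keys q"
  have "keys (p + q) \<subseteq> ?A"
    by (rule Poly_Mapping.keys_add)
  then show ?thesis
    by (simp add: ps_superset[of ?A] lookup_add hom_add distrib_right sum.distrib)
qed

lemma ps_sum: "poly_subst \<phi> \<sigma> (sum f A) = (\<Sum>a\<in>A. poly_subst \<phi> \<sigma> (f a))"
  by (induction A rule: infinite_finite_induct) (simp_all add: ps_add)

lemma ps_mult: "poly_subst \<phi> \<sigma> (p * q) = poly_subst \<phi> \<sigma> p * poly_subst \<phi> \<sigma> q"
proof -
  have "p * q = (\<Sum>m\<in>keys p. \<Sum>n\<in>keys q. single (m + n) (lookup p m * lookup q n))"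
    by (subst (1) sum_single_lookup[of p], subst (1) sum_single_lookup[of q])
      (simp add: sum_product mult_single)
  then have "poly_subst \<phi> \<sigma> (p * q) = (\<Sum>m\<in>keys p. \<Sum>n\<in>keys q.
      (\<phi> (lookup p m) * meval \<sigma> m) * (\<phi> (lookup q n) * meval \<sigma> n))"
    by (simp add: ps_sum meval_add hom_mult mult_ac)
  also have "\<dots> = poly_subst \<phi> \<sigma> p * poly_subst \<phi> \<sigma> q"
    by (simp add: sum_product poly_subst_def meval_def)
  finally show ?thesis .
qed

lemma ps_1 [simp]: "poly_subst \<phi> \<sigma> 1 = 1"
  using ps_single[of \<sigma> 0 1] by simp

lemma ps_prod: "poly_subst \<phi> \<sigma> (prod f A) = (\<Prod>a\<in>A. poly_subst \<phi> \<sigma> (f a))"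
  by (induction A rule: infinite_finite_induct) (simp_all add: ps_mult)

lemma ps_power: "poly_subst \<phi> \<sigma> (p ^ n) = poly_subst \<phi> \<sigma> p ^ n"
  by (induction n) (simp_all add: ps_mult)

lemma ps_uminus: "poly_subst \<phi> \<sigma> (- p) = - poly_subst \<phi> \<sigma> p"
proof -
  have "poly_subst \<phi> \<sigma> (- p) + poly_subst \<phi> \<sigma> p = poly_subst \<phi> \<sigma> (- p + p)"
    by (simp only: ps_add)
  then show ?thesis
    by (simp add: eq_neg_iff_add_eq_0)
qed

lemma ps_minus: "poly_subst \<phi> \<sigma> (p - q) = poly_subst \<phi> \<sigma> p - poly_subst \<phi> \<sigma> q"
  using ps_add[of \<sigma> p "- q"] by (simp add: ps_uminus)

lemma ps_Var [simp]: "poly_subst \<phi> \<sigma> (Var v) = \<sigma> v"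
  by (simp add: Var_def)

lemma ps_Const [simp]: "poly_subst \<phi> \<sigma> (Const c) = \<phi> c"
  by (simp add: Const_def)

lemma ps_meval: "poly_subst \<phi> \<tau> (meval \<sigma> m) = meval (\<lambda>v. poly_subst \<phi> \<tau> (\<sigma> v)) m"
  by (simp add: meval_def ps_prod ps_power)

lemma ps_det: "poly_subst \<phi> \<sigma> (det M) = det (map_mat (poly_subst \<phi> \<sigma>) M)"
proof -
  interpret comm_ring_hom "poly_subst \<phi> \<sigma>"
    by unfold_locales (simp_all add: ps_add ps_mult)
  show ?thesis by simp
qed

end

interpretation subst_Const: coeff_hom Const
  by unfold_locales (simp_all add: Const_def single_add mult_single)

interpretation subst_id: coeff_hom id
  by unfold_locales simp_all

lemma (in coeff_hom) ps_comp:
  "poly_subst \<phi> \<tau> (poly_subst Const \<sigma> p) = poly_subst \<phi> (\<lambda>v. poly_subst \<phi> \<tau> (\<sigma> v)) p"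
  unfolding poly_subst_def[of Const] poly_subst_def[of \<phi> "\<lambda>v. poly_subst \<phi> \<tau> (\<sigma> v)"]
    meval_def[symmetric]
  by (simp add: ps_sum ps_mult ps_meval)

lemma rename_subst: "rename f p = poly_subst Const (\<lambda>v. Var (f v)) p"
  by (simp add: rename_def)


section \<open>Ideals in polynomial rings\<close>

lemma polys_iff: "p \<in> polys V \<longleftrightarrow> (\<forall>m\<in>keys p. keys m \<subseteq> V)"
  by (auto simp: poly_ring_def monomials_def)

lemma poly_ring_simps [simp]:
  "monoid.mult (poly_ring V) = (*)" "one (poly_ring V) = 1"
  "zero (poly_ring V) = 0" "add (poly_ring V) = (+)"
  by (simp_all add: poly_ring_def)

lemma polys_0 [simp]: "0 \<in> polys V" and polys_1 [simp]: "1 \<in> polys V"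
  by (simp_all add: polys_iff)

lemma polys_add: "p \<in> polys V \<Longrightarrow> q \<in> polys V \<Longrightarrow> p + q \<in> polys V"
  using Poly_Mapping.keys_add[of p q] by (auto simp: polys_iff)

lemma polys_mult: "p \<in> polys V \<Longrightarrow> q \<in> polys V \<Longrightarrow> p * q \<in> polys V"
proof -
  interpret cring "poly_ring V" by (rule poly_ring_cring)
  show "p \<in> polys V \<Longrightarrow> q \<in> polys V \<Longrightarrow> p * q \<in> polys V"
    using m_closed[of p q] by simp
qed

lemma polys_uminus: "p \<in> polys V \<Longrightarrow> - p \<in> polys V"
  by (auto simp: polys_iff in_keys_iff)

lemma polys_minus: "p \<in> polys V \<Longrightarrow> q \<in> polys V \<Longrightarrow> p - q \<in> polys V"
  using polys_add[of p V "- q"] polys_uminus[of q V] by simp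

lemma polys_sum: "(\<And>a. a \<in> A \<Longrightarrow> f a \<in> polys V) \<Longrightarrow> sum f A \<in> polys V"
  by (induction A rule: infinite_finite_induct) (auto intro: polys_add)

lemma polys_prod: "(\<And>a. a \<in> A \<Longrightarrow> f a \<in> polys V) \<Longrightarrow> prod f A \<in> polys V"
  by (induction A rule: infinite_finite_induct) (auto intro: polys_mult)

lemma polys_power: "p \<in> polys V \<Longrightarrow> p ^ n \<in> polys V"
  by (induction n) (auto intro: polys_mult)

lemma polys_Var: "v \<in> V \<Longrightarrow> Var v \<in> polys V"
  by (simp add: polys_iff Var_def)

lemma polys_Const: "Const c \<in> polys V"
  by (simp add: polys_iff Const_def)

lemma polys_single: "keys m \<subseteq> V \<Longrightarrow> single m c \<in> polys V"
  by (simp add: polys_iff)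

lemma polys_subst:
  assumes "p \<in> polys V" "\<And>v. v \<in> V \<Longrightarrow> \<sigma> v \<in> polys W"
  shows "poly_subst Const \<sigma> p \<in> polys W"
  unfolding poly_subst_def
proof (intro polys_sum polys_mult polys_Const polys_prod polys_power)
  fix m v assume "m \<in> keys p" "v \<in> keys m"
  with assms(1) have "v \<in> V" by (auto simp: polys_iff)
  then show "\<sigma> v \<in> polys W" by (rule assms(2))
qed

text \<open>Negatives come from multiplication by the constant -1, so closure under sums and
  multiples suffices.\<close>

lemma poly_idealI:
  assumes "S \<subseteq> polys V" "0 \<in> S" "\<And>p q. p \<in> S \<Longrightarrow> q \<in> S \<Longrightarrow> p + q \<in> S"
    and "\<And>p q. p \<in> S \<Longrightarrow> q \<in> polys V \<Longrightarrow> q * p \<in> S"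
  shows "ideal S (poly_ring V)"
proof -
  interpret cring "poly_ring V" by (rule poly_ring_cring)
  have neg: "- p \<in> S" if "p \<in> S" for p
    using assms(4)[OF that polys_Const[of "- 1"]] by (simp add: Const_def single_uminus)
  show ?thesis
  proof (rule idealI)
    show "subgroup S (add_monoid (poly_ring V))"
    proof (rule group.subgroupI)
      show "Group.group (add_monoid (poly_ring V))" by (rule a_group)
      fix p assume p: "p \<in> S"
      have "inv\<^bsub>add_monoid (poly_ring V)\<^esub> p = - p"
        using p assms(1) polys_uminus[of p V]
        by (intro group.inv_equality[OF a_group]) auto
      with neg p show "inv\<^bsub>add_monoid (poly_ring V)\<^esub> p \<in> S" by simp
    qed (use assms in auto)
  qed (use assms in \<open>auto simp: ring_axioms mult.commute\<close>)
qed

lemma ideal_subset_polys: "ideal S (poly_ring V) \<Longrightarrow> S \<subseteq> polys V"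
  using additive_subgroup.a_subset ideal.axioms(1) by blast

lemma ideal_0: "ideal S (poly_ring V) \<Longrightarrow> 0 \<in> S"
  using additive_subgroup.zero_closed[OF ideal.axioms(1)] by force

lemma ideal_add: "ideal S (poly_ring V) \<Longrightarrow> p \<in> S \<Longrightarrow> q \<in> S \<Longrightarrow> p + q \<in> S"
  using additive_subgroup.a_closed[OF ideal.axioms(1)] by force

lemma ideal_mult: "ideal S (poly_ring V) \<Longrightarrow> p \<in> S \<Longrightarrow> q \<in> polys V \<Longrightarrow> q * p \<in> S"
  using ideal.I_l_closed by force

lemma ideal_uminus: "ideal S (poly_ring V) \<Longrightarrow> p \<in> S \<Longrightarrow> - p \<in> S"
  using ideal_mult[of S V p "Const (- 1)"] polys_Const[of "- 1" V]
  by (simp add: Const_def single_uminus)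

lemma ideal_sum: "ideal S (poly_ring V) \<Longrightarrow> (\<And>a. a \<in> A \<Longrightarrow> f a \<in> S) \<Longrightarrow> sum f A \<in> S"
  by (induction A rule: infinite_finite_induct) (auto intro: ideal_add ideal_0)

lemma Idl_ideal: "S \<subseteq> polys V \<Longrightarrow> ideal (Idl\<^bsub>poly_ring V\<^esub> S) (poly_ring V)"
  using ring.genideal_ideal[OF cring.axioms(1)[OF poly_ring_cring]] .

lemma Idl_self: "S \<subseteq> polys V \<Longrightarrow> p \<in> S \<Longrightarrow> p \<in> Idl\<^bsub>poly_ring V\<^esub> S"
  using ring.genideal_self[OF cring.axioms(1)[OF poly_ring_cring]] by blast

lemma Idl_minimal: "ideal J (poly_ring V) \<Longrightarrow> S \<subseteq> J \<Longrightarrow> Idl\<^bsub>poly_ring V\<^esub> S \<subseteq> J"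
  using ring.genideal_minimal[OF cring.axioms(1)[OF poly_ring_cring]] .

lemma (in coeff_hom) ker_ideal: "ideal {p \<in> polys V. poly_subst \<phi> \<sigma> p = 0} (poly_ring V)"
  by (rule poly_idealI) (auto simp: ps_add ps_mult polys_add polys_mult)

text \<open>Substitutions that agree modulo \<open>J\<close> give values that agree modulo
  \<open>J\<close>. Powers and products are treated by telescoping, a a' - b b' = a (a' - b') + b'
  (a - b).\<close>

lemma ideal_subst_diff:
  fixes p :: "('v, 'a::comm_ring_1) mpoly" and J :: "('w, 'a) mpoly set"
  assumes J: "ideal J (poly_ring W)" and p: "p \<in> polys V"
    and \<sigma>: "\<And>v. v \<in> V \<Longrightarrow> \<sigma> v \<in> polys W" and \<tau>: "\<And>v. v \<in> V \<Longrightarrow> \<tau> v \<in> polys W"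
    and diff: "\<And>v. v \<in> V \<Longrightarrow> \<sigma> v - \<tau> v \<in> J"
  shows "poly_subst Const \<sigma> p - poly_subst Const \<tau> p \<in> J"
proof -
  have pow: "a ^ n - b ^ n \<in> J" if "a - b \<in> J" "a \<in> polys W" "b \<in> polys W"
    for a b :: "('w, 'a) mpoly" and n :: nat
  proof (induction n)
    case (Suc n)
    have "a ^ Suc n - b ^ Suc n = a * (a ^ n - b ^ n) + b ^ n * (a - b)"
      by (simp add: algebra_simps)
    with Suc that show ?case
      by (auto intro!: ideal_add[OF J] ideal_mult[OF J] polys_power)
  qed (simp add: ideal_0[OF J])
  have prod: "prod f A - prod g A \<in> J"
    if "\<And>a. a \<in> A \<Longrightarrow> f a - g a \<in> J \<and> f a \<in> polys W \<and> g a \<in> polys W"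
    for f g :: "'v \<Rightarrow> ('w, 'a) mpoly" and A
    using that
  proof (induction A rule: infinite_finite_induct)
    case (insert x A)
    have "prod f (insert x A) - prod g (insert x A)
        = f x * (prod f A - prod g A) + prod g A * (f x - g x)"
      using insert.hyps by (simp add: algebra_simps)
    with insert show ?case
      by (auto intro!: ideal_add[OF J] ideal_mult[OF J] polys_prod)
  qed (simp_all add: ideal_0[OF J])
  have "meval \<sigma> m - meval \<tau> m \<in> J" if "m \<in> keys p" for m
    unfolding meval_def
  proof (intro prod conjI pow polys_power)
    fix v assume "v \<in> keys m"
    with that p have "v \<in> V" by (auto simp: polys_iff)
    then show "\<sigma> v - \<tau> v \<in> J" "\<sigma> v \<in> polys W" "\<tau> v \<in> polys W"
      "\<sigma> v \<in> polys W" "\<tau> v \<in> polys W"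
      by (rule diff \<sigma> \<tau>)+
  qed
  then have "(\<Sum>m\<in>keys p. Const (lookup p m) * (meval \<sigma> m - meval \<tau> m)) \<in> J"
    by (intro ideal_sum[OF J] ideal_mult[OF J] polys_Const)
  then show ?thesis
    unfolding poly_subst_def meval_def[symmetric]
    by (simp add: algebra_simps sum_subtractf)
qed

section \<open>The poset of indeterminates\<close>

text \<open>Block indices add up by the Hankel shape, and positions within a block add up because
  each block is symmetric. The formula serves \<open>block_hankel d k\<close> for every
  \<open>k\<close>.\<close>

definition entry_index :: "nat \<Rightarrow> nat \<Rightarrow> nat \<times> nat" where
  "entry_index p q = (p div 2 + q div 2, p mod 2 + q mod 2)"

text \<open>Each indeterminate is given one preferred position in \<open>X\<^bsub>\<lfloor>d/2\<rfloor>\<^esub>\<close>, as close as possible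
  to the main diagonal.  The positions are chosen such that the indeterminates at \<open>(p, q)\<close> and
  \<open>(p', q')\<close> with \<open>p < p'\<close> and \<open>q < q'\<close> also have increasing preferred positions.\<close>

fun hbit :: "nat \<times> nat \<Rightarrow> nat" where
  "hbit (i, j) = (if (if even i then 2 \<le> j else 1 \<le> j) then 1 else 0)"

fun hrow :: "nat \<times> nat \<Rightarrow> nat" where
  "hrow (i, j) = 2 * (i div 2) + hbit (i, j)"

fun hcol :: "nat \<times> nat \<Rightarrow> nat" where
  "hcol (i, j) = 2 * ((i + 1) div 2) + (j - hbit (i, j))"

definition below :: "nat \<times> nat \<Rightarrow> nat \<times> nat \<Rightarrow> bool" where
  "below v w \<longleftrightarrow> hrow v < hrow w \<and> hcol v < hcol w"

definition chain :: "(nat \<times> nat) set \<Rightarrow> bool" where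
  "chain C \<longleftrightarrow> (\<forall>v\<in>C. \<forall>w\<in>C. v \<noteq> w \<longrightarrow> below v w \<or> below w v)"

lemma below_irrefl [simp]: "\<not> below v v"
  by (simp add: below_def)

lemma below_trans: "below u v \<Longrightarrow> below v w \<Longrightarrow> below u w"
  by (auto simp: below_def)

lemma chain_subset: "chain C \<Longrightarrow> D \<subseteq> C \<Longrightarrow> chain D"
  unfolding chain_def by blast

text \<open>The block coordinates \<open>i div 2\<close> and \<open>(i + 1) div 2\<close> split
  \<open>i\<close> as evenly as possible, and \<open>hbit\<close> splits \<open>j\<close> into two
  parts of size at most 1. The column exceeds the row by 0, 1, 0 for j = 0, 1, 2 when
  \<open>i\<close> is even, and by 2, 1, 2 when \<open>i\<close> is odd.\<close>

lemma entry_index_hrow_hcol: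
  assumes "v \<in> sv_vars d"
  shows "entry_index (hrow v) (hcol v) = v"
proof -
  obtain i j where v: "v = (i, j)" by (cases v)
  have "j \<le> 2" using assms v by (simp add: sv_vars_def)
  then consider "j = 0" | "j = 1" | "j = 2" by linarith
  moreover have "i div 2 + (i + 1) div 2 = i" by presburger
  moreover have "(2 * a + 1) mod 2 = (1::nat)" "(2 * a + 1) div 2 = a" for a by presburger+
  ultimately show ?thesis unfolding v
    by cases (auto simp: entry_index_def)
qed

lemma double_bound: "x \<le> y \<Longrightarrow> e \<le> 1 \<Longrightarrow> 2 * x + e < 2 * (y + 1)" for x y e :: nat
  by simp

lemma hrow_bound: "v \<in> sv_vars d \<Longrightarrow> hrow v < 2 * (d div 2 + 1)"
proof -
  assume v: "v \<in> sv_vars d"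
  obtain i j where [simp]: "v = (i, j)" by (cases v)
  have "i div 2 \<le> d div 2" using v by (auto simp: sv_vars_def intro: div_le_mono)
  moreover have "hbit (i, j) \<le> 1" by auto
  ultimately show ?thesis by (simp only: \<open>v = (i, j)\<close> hrow.simps double_bound)
qed

text \<open>Here the middle matrix matters: the largest block column is
  \<open>(d + 1) div 2\<close>, which equals \<open>d - d div 2\<close>.\<close>

lemma hcol_bound: "v \<in> sv_vars d \<Longrightarrow> hcol v < 2 * (d - d div 2 + 1)"
proof -
  assume v: "v \<in> sv_vars d"
  obtain i j where [simp]: "v = (i, j)" by (cases v)
  have "(i + 1) div 2 \<le> (d + 1) div 2" "j \<le> 2"
    using v by (auto simp: sv_vars_def intro: div_le_mono)
  moreover have "(d + 1) div 2 = d - d div 2" by presburger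
  moreover have "j - hbit (i, j) \<le> 1" using \<open>j \<le> 2\<close> by auto
  ultimately show ?thesis by (simp only: \<open>v = (i, j)\<close> hcol.simps double_bound)
qed

lemma hrow_plus_hcol: "hrow (i, j) + hcol (i, j) = 2 * i + j"
  by (simp; presburger)

text \<open>This and the next two lemmas supply the comparable pairs that confine the support of a
  standard monomial to at most two consecutive first indices.\<close>

lemma below_same: "below (i, 0) (i, 2)"
  by (simp add: below_def)

lemma below_Suc: "j \<le> 1 \<Longrightarrow> 1 \<le> k \<Longrightarrow> k \<le> 2 \<Longrightarrow> below (i, j) (Suc i, k)"
  by (cases "even i") (auto simp: below_def elim!: evenE oddE)

lemma below_far:
  assumes "i + 2 \<le> i'" "j \<le> 2" "j' \<le> 2"
  shows "below (i, j) (i', j')"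
proof -
  have "i div 2 + 1 \<le> i' div 2" "(i + 1) div 2 + 1 \<le> (i' + 1) div 2"
    using assms(1) by presburger+
  moreover have "j - hbit (i, j) \<le> 1" using assms(2) by auto
  moreover have "hbit (i, j) \<le> 1" by auto
  ultimately show ?thesis unfolding below_def hrow.simps hcol.simps by linarith
qed

text \<open>\<open>F\<close> consists of the minimal elements. A nonempty chain outside
  \<open>F\<close> has a least element, which is not minimal in \<open>S\<close>, so the chain can
  be prolonged downwards. The empty chain always exists, hence the conclusion \<open>n = 0\<close>
  instead of a contradiction. The lemma drives both Mirsky's theorem and the join of chain
  ideals.\<close>

lemma chain_split_minimal:
  assumes S: "finite S" and no: "\<And>C. C \<subseteq> S \<Longrightarrow> chain C \<Longrightarrow> card C \<noteq> Suc n"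
  obtains F where "F \<subseteq> S" "\<And>v w. v \<in> F \<Longrightarrow> w \<in> F \<Longrightarrow> \<not> below v w"
    "\<And>C. C \<subseteq> S - F \<Longrightarrow> chain C \<Longrightarrow> card C = n \<Longrightarrow> n = 0"
proof
  define F where "F = {v \<in> S. \<forall>w\<in>S. \<not> below w v}"
  show "F \<subseteq> S" "\<And>v w. v \<in> F \<Longrightarrow> w \<in> F \<Longrightarrow> \<not> below v w"
    by (auto simp: F_def)
  fix C assume C: "C \<subseteq> S - F" "chain C" "card C = n"
  show "n = 0"
  proof (rule ccontr)
    assume "n \<noteq> 0"
    have finC: "finite C" using C(1) S finite_subset by blast
    have "C \<noteq> {}" using C(3) \<open>n \<noteq> 0\<close> by auto
    \<comment> \<open>In a chain the element with the smallest row is the least one, since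
      \<open>below\<close> forces a smaller row.\<close>
    then obtain c where c: "c \<in> C" "\<And>v. v \<in> C \<Longrightarrow> hrow c \<le> hrow v"
      using finC ex_min_if_finite[of "hrow ` C"] by (metis arg_min_on_def arg_min_if_finite(1,2) not_le)
    from c(1) C(1) obtain w where w: "w \<in> S" "below w c"
      unfolding F_def by blast
    have least: "below w v" if "v \<in> C" for v
    proof (cases "v = c")
      case False
      with C(2) c(1) that have "below c v \<or> below v c" unfolding chain_def by blast
      with c(2)[OF that] have "below c v" unfolding below_def by linarith
      with w(2) show ?thesis by (rule below_trans)
    qed (use w in simp)
    from least[of w] have "w \<notin> C" by auto
    have "chain (insert w C)"
      using C(2) least unfolding chain_def by blast
    moreover have "insert w C \<subseteq> S" using w C(1) by blast
    ultimately have "card (insert w C) \<noteq> Suc n" by (rule no[rotated])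
    with \<open>w \<notin> C\<close> finC C(3) show False by simp
  qed
qed

text \<open>Mirsky's theorem for the poset of indeterminates.\<close>

lemma chain_colouring:
  assumes "finite S" "\<And>C. C \<subseteq> S \<Longrightarrow> chain C \<Longrightarrow> card C \<noteq> Suc r"
  shows "\<exists>f. (\<forall>v\<in>S. f v < r) \<and> (\<forall>v\<in>S. \<forall>w\<in>S. f v = f w \<longrightarrow> \<not> below v w)"
  using assms
proof (induction r arbitrary: S)
  case 0
  have "S = {}"
  proof (rule ccontr)
    assume "S \<noteq> {}"
    then obtain v where "v \<in> S" by blast
    with 0(2)[of "{v}"] show False by (simp add: chain_def)
  qed
  then show ?case by simp
next
  case (Suc r)
  obtain F where F: "F \<subseteq> S" "\<And>v w. v \<in> F \<Longrightarrow> w \<in> F \<Longrightarrow> \<not> below v w"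
    "\<And>C. C \<subseteq> S - F \<Longrightarrow> chain C \<Longrightarrow> card C = Suc r \<Longrightarrow> Suc r = 0"
    using chain_split_minimal[OF Suc.prems] by metis
  have "\<exists>f. (\<forall>v\<in>S - F. f v < r) \<and> (\<forall>v\<in>S - F. \<forall>w\<in>S - F. f v = f w \<longrightarrow> \<not> below v w)"
    by (rule Suc.IH) (use F(3) Suc.prems(1) in auto)
  then obtain f where f: "\<forall>v\<in>S - F. f v < r"
    "\<forall>v\<in>S - F. \<forall>w\<in>S - F. f v = f w \<longrightarrow> \<not> below v w"
    by blast
  show ?case
    by (rule exI[of _ "\<lambda>v. if v \<in> F then 0 else Suc (f v)"]) (use F f in auto)
qed


section \<open>Standard monomials\<close>

text \<open>The exponent of a parameter a in the image of \<open>m\<close> under v -> a^(g v). The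
  constant 1, \<open>fst\<close> and \<open>snd\<close> give the exponents of t, u and v.\<close>

definition wsum :: "('v \<Rightarrow> nat) \<Rightarrow> 'v monomial \<Rightarrow> nat" where
  "wsum g m = (\<Sum>v\<in>keys m. lookup m v * g v)"

lemma wsum_superset:
  "finite A \<Longrightarrow> keys m \<subseteq> A \<Longrightarrow> wsum g m = (\<Sum>v\<in>A. lookup m v * g v)"
  unfolding wsum_def by (intro sum.mono_neutral_left) (auto simp: in_keys_iff)

lemma wsum_0 [simp]: "wsum g 0 = 0"
  by (simp add: wsum_def)

lemma wsum_single [simp]: "wsum g (single v n) = n * g v"
  by (subst wsum_superset[of "{v}"]) auto

lemma wsum_add: "wsum g (m + n) = wsum g m + wsum g n"
proof -
  have "keys (m + n) \<subseteq> keys m \<union> keys n" by (rule Poly_Mapping.keys_add)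
  then show ?thesis
    by (simp add: wsum_superset[of "keys m \<union> keys n"] lookup_add distrib_right sum.distrib)
qed

lemma wsum_plus: "wsum (\<lambda>v. f v + g v) m = wsum f m + wsum g m"
  by (simp add: wsum_def distrib_left sum.distrib)

lemma wsum_mult: "wsum (\<lambda>v. c * g v) m = c * wsum g m"
  by (simp add: wsum_def sum_distrib_left mult_ac)

lemma wsum_mono: "(\<And>v. v \<in> keys m \<Longrightarrow> f v \<le> g v) \<Longrightarrow> wsum f m \<le> wsum g m"
  unfolding wsum_def by (intro sum_mono mult_left_mono) auto

lemma wsum_strict_mono:
  assumes "\<And>v. v \<in> keys m \<Longrightarrow> f v \<le> g v" "u \<in> keys m" "f u < g u"
  shows "wsum f m < wsum g m"
  unfolding wsum_def using assms
  by (intro sum_strict_mono_ex1) (auto simp: in_keys_iff)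

definition same_weight :: "(nat \<times> nat) monomial \<Rightarrow> (nat \<times> nat) monomial \<Rightarrow> bool" where
  "same_weight m n \<longleftrightarrow> wsum (\<lambda>_. 1) m = wsum (\<lambda>_. 1) n \<and> wsum fst m = wsum fst n \<and>
     wsum snd m = wsum snd n"

definition standard :: "(nat \<times> nat) monomial \<Rightarrow> bool" where
  "standard m \<longleftrightarrow> (\<forall>v\<in>keys m. \<forall>w\<in>keys m. \<not> below v w)"

lemma same_weight_refl [simp]: "same_weight m m"
  by (simp add: same_weight_def)

lemma same_weight_sym: "same_weight m n \<Longrightarrow> same_weight n m"
  by (simp add: same_weight_def)

lemma same_weight_trans: "same_weight l m \<Longrightarrow> same_weight m n \<Longrightarrow> same_weight l n"
  by (simp add: same_weight_def)

text \<open>The lexicographically largest indeterminate \<open>(I, J)\<close> of a standard monomial of degree \<open>n\<close>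
  can be read off from its weight: \<open>L\<close> counts the factors with first index \<open>I - 1\<close>, and all of
  them are \<open>(I - 1, 2)\<close> unless \<open>J = 0\<close>.\<close>

lemma standard_top:
  assumes std: "standard m" and m: "keys m \<subseteq> sv_vars d" "m \<noteq> 0"
  obtains I J L where "(I, J) \<in> keys m" "wsum (\<lambda>_. 1) m * I = wsum fst m + L"
    "L < wsum (\<lambda>_. 1) m" "wsum snd m \<le> 2 * L + (wsum (\<lambda>_. 1) m - L) * J"
    "1 \<le> J \<Longrightarrow> 2 * L + (wsum (\<lambda>_. 1) m - L) * (J - 1) < wsum snd m"
proof -
  define I where "I = Max (fst ` keys m)"
  define J where "J = Max {j. (I, j) \<in> keys m}"
  have fin: "finite {j. (I, j) \<in> keys m}"
    by (rule finite_subset[of _ "snd ` keys m"]) (auto intro: rev_image_eqI)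
  have "I \<in> fst ` keys m" unfolding I_def using m by (intro Max_in) auto
  then have "{j. (I, j) \<in> keys m} \<noteq> {}" by force
  then have IJ: "(I, J) \<in> keys m" unfolding J_def using Max_in[OF fin] by blast
  have J2: "J \<le> 2" using IJ m(1) by (auto simp: sv_vars_def)
  have maxJ: "j \<le> J" if "(I, j) \<in> keys m" for j
    unfolding J_def using fin that by (intro Max_ge) auto
  \<comment> \<open>Anything else in the support would be comparable with (I, J) by
    \<open>below_far\<close>, \<open>below_same\<close> or \<open>below_Suc\<close>.\<close>
  have cases: "(i = I \<and> j \<le> J \<and> J \<le> j + 1) \<or> (Suc i = I \<and> (1 \<le> J \<longrightarrow> j = 2))"
    and j2: "j \<le> 2" if "(i, j) \<in> keys m" for i j
  proof -
    show j2: "j \<le> 2" using that m(1) by (auto simp: sv_vars_def)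
    have "i \<le> I" unfolding I_def using that by (force intro: Max_ge)
    moreover have "\<not> i + 2 \<le> I"
      using below_far[of i I j J] std IJ that J2 j2 unfolding standard_def by blast
    ultimately consider "i = I" | "Suc i = I" by linarith
    then show "(i = I \<and> j \<le> J \<and> J \<le> j + 1) \<or> (Suc i = I \<and> (1 \<le> J \<longrightarrow> j = 2))"
    proof cases
      case 1
      have "\<not> (j = 0 \<and> J = 2)"
        using below_same[of I] std IJ that 1 unfolding standard_def by blast
      with maxJ[of j] that 1 J2 show ?thesis by auto
    next
      case 2
      have "\<not> (j \<le> 1 \<and> 1 \<le> J)"
        using below_Suc[of j J i] std IJ that 2 J2 unfolding standard_def by blast
      with 2 j2 show ?thesis by auto
    qed
  qed
  \<comment> \<open>On the support \<open>I - fst v\<close> is 0 or 1. The truncated difference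
    \<open>1 - (I - fst v)\<close> is the complementary indicator, so \<open>R\<close> counts the
    factors with first index \<open>I\<close>.\<close>
  define n L where "n = wsum (\<lambda>_. 1) m" and "L = wsum (\<lambda>v. I - fst v) m"
  define R where "R = wsum (\<lambda>v. 1 - (I - fst v)) m"
  have nI: "n * I = wsum (\<lambda>v. I) m"
    using wsum_mult[of I "\<lambda>_. 1" m] by (simp add: n_def)
  also have "\<dots> = wsum (\<lambda>v. fst v + (I - fst v)) m"
    unfolding wsum_def by (intro sum.cong) (use cases in fastforce)+
  finally have 1: "n * I = wsum fst m + L" by (simp add: wsum_plus L_def)
  have "n = wsum (\<lambda>v. (I - fst v) + (1 - (I - fst v))) m"
    unfolding n_def wsum_def by (intro sum.cong) (use cases in fastforce)+
  then have nLR: "n = L + R" unfolding L_def R_def wsum_plus .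
  have 2: "L < n" unfolding L_def n_def
    by (rule wsum_strict_mono[OF _ IJ]) (use cases in fastforce)+
  have "wsum snd m \<le> wsum (\<lambda>v. 2 * (I - fst v) + J * (1 - (I - fst v))) m"
    by (rule wsum_mono) (use cases j2 in fastforce)
  then have 3: "wsum snd m \<le> 2 * L + R * J"
    unfolding wsum_plus wsum_mult L_def[symmetric] R_def[symmetric] by (simp add: mult.commute)
  \<comment> \<open>Now each factor with first index I - 1 contributes exactly 2 and each factor
    with first index I at least J - 1; the factor (I, J) itself makes the bound strict.\<close>
  have 4: "2 * L + R * (J - 1) < wsum snd m" if "1 \<le> J"
  proof -
    have "wsum (\<lambda>v. 2 * (I - fst v) + (J - 1) * (1 - (I - fst v))) m < wsum snd m"
      by (rule wsum_strict_mono[OF _ IJ]) (use cases that in fastforce)+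
    then show ?thesis
      unfolding wsum_plus wsum_mult L_def[symmetric] R_def[symmetric] by (simp add: mult.commute)
  qed
  have "n - L = R" using nLR by simp
  with that[OF IJ] 1 2 3 4 show thesis unfolding n_def by metis
qed

text \<open>The inequalities say that I is A / n rounded up, which fixes L, and that J is (B - 2 L)
  / (n - L) rounded up, or 0 if B is at most 2 L.\<close>

lemma top_coordinates_unique:
  fixes n A B I J L I' J' L' :: nat
  assumes "n * I = A + L" "n * I' = A + L'" "L < n" "L' < n"
    "B \<le> 2 * L + (n - L) * J" "B \<le> 2 * L' + (n - L') * J'"
    "1 \<le> J \<Longrightarrow> 2 * L + (n - L) * (J - 1) < B" "1 \<le> J' \<Longrightarrow> 2 * L' + (n - L') * (J' - 1) < B"
  shows "I = I' \<and> J = J'"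
proof -
  have gap: "I \<le> I'" if "n * I = A + L" "n * I' = A + L'" "L < n" for I I' L L' :: nat
  proof (rule ccontr)
    assume "\<not> I \<le> I'"
    then have "n * (I' + 1) \<le> n * I" by (intro mult_le_mono2) simp
    with that show False by simp
  qed
  have I: "I = I'"
    using gap[OF assms(1,2,3)] gap[OF assms(2,1,4)] by simp
  then have L: "L' = L" using assms(1,2) by simp
  have gapJ: "J \<le> J'" if "B \<le> 2 * L + (n - L) * J'" "1 \<le> J \<Longrightarrow> 2 * L + (n - L) * (J - 1) < B"
    for J J' :: nat
  proof (rule ccontr)
    assume J: "\<not> J \<le> J'"
    then have "(n - L) * J' \<le> (n - L) * (J - 1)" by (intro mult_le_mono2) simp
    moreover have "2 * L + (n - L) * (J - 1) < B" using J by (intro that(2)) simp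
    ultimately show False using that(1) by linarith
  qed
  have "J = J'"
    using gapJ[OF assms(5) assms(8)[unfolded L]] gapJ[OF assms(6)[unfolded L] assms(7)] by simp
  with I show ?thesis by simp
qed

text \<open>The common weight determines the largest indeterminate, so both monomials share it.
  Removing one copy keeps the weights equal and the supports antichains, which allows induction on
  the degree.\<close>

lemma standard_unique:
  assumes "standard m" "standard m'" "keys m \<subseteq> sv_vars d" "keys m' \<subseteq> sv_vars d"
    "same_weight m m'"
  shows "m = m'"
  using assms
proof (induction "wsum (\<lambda>_. 1) m" arbitrary: m m')
  case 0
  have "m = 0" if "wsum (\<lambda>_. 1) m = 0" for m :: "(nat \<times> nat) monomial"
    using that by (auto simp: wsum_def in_keys_iff intro: poly_mapping_eqI)
  from this[of m] this[of m'] 0 show ?case unfolding same_weight_def by metis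
next
  case (Suc n)
  note w = Suc.prems(5)[unfolded same_weight_def]
  have "m \<noteq> 0" "m' \<noteq> 0" using Suc.hyps(2) w by auto
  from standard_top[OF Suc.prems(1,3) \<open>m \<noteq> 0\<close>] obtain I J L where
    t: "(I, J) \<in> keys m" "wsum (\<lambda>_. 1) m * I = wsum fst m + L"
    "L < wsum (\<lambda>_. 1) m" "wsum snd m \<le> 2 * L + (wsum (\<lambda>_. 1) m - L) * J"
    "1 \<le> J \<Longrightarrow> 2 * L + (wsum (\<lambda>_. 1) m - L) * (J - 1) < wsum snd m" by metis
  from standard_top[OF Suc.prems(2,4) \<open>m' \<noteq> 0\<close>] obtain I' J' L' where
    t': "(I', J') \<in> keys m'" "wsum (\<lambda>_. 1) m' * I' = wsum fst m' + L'"
    "L' < wsum (\<lambda>_. 1) m'" "wsum snd m' \<le> 2 * L' + (wsum (\<lambda>_. 1) m' - L') * J'"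
    "1 \<le> J' \<Longrightarrow> 2 * L' + (wsum (\<lambda>_. 1) m' - L') * (J' - 1) < wsum snd m'" by metis
  have "I = I' \<and> J = J'"
    using t' w by (intro top_coordinates_unique[OF t(2) _ t(3) _ t(4) _ t(5)]) auto
  then have [simp]: "I' = I" "J' = J" by auto
  let ?s = "single (I, J) 1"
  have dec: "\<exists>m1. m = m1 + ?s \<and> keys m1 \<subseteq> keys m" if "(I, J) \<in> keys m"
    for m :: "(nat \<times> nat) monomial"
  proof (intro exI conjI)
    show "m = (m - ?s) + ?s"
      using that by (auto intro!: poly_mapping_eqI simp: lookup_add lookup_minus lookup_single
          when_def in_keys_iff)
    show "keys (m - ?s) \<subseteq> keys m" by (auto simp: in_keys_iff lookup_minus)
  qed
  obtain m1 where m1: "m = m1 + ?s" "keys m1 \<subseteq> keys m" using dec[OF t(1)] by blast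
  obtain m1' where m1': "m' = m1' + ?s" "keys m1' \<subseteq> keys m'" using dec t'(1) by auto
  have "m1 = m1'"
  proof (rule Suc.hyps(1))
    show "n = wsum (\<lambda>_. 1) m1" using Suc.hyps(2) m1(1) by (simp add: wsum_add)
    show "same_weight m1 m1'"
      using Suc.prems(5) unfolding m1(1) m1'(1) same_weight_def by (simp add: wsum_add)
    show "standard m1" "standard m1'"
      using Suc.prems(1,2) m1(2) m1'(2) unfolding standard_def by blast+
  qed (use Suc.prems m1(2) m1'(2) in auto)
  with m1 m1' show ?case by simp
qed

text \<open>One reduction step replaces the main diagonal of a \<open>2 \<times> 2\<close> minor by its antidiagonal.\<close>

definition hstep :: "nat \<Rightarrow> (nat \<times> nat) monomial \<Rightarrow> (nat \<times> nat) monomial \<Rightarrow> bool" where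
  "hstep d m m' \<longleftrightarrow> (\<exists>\<delta> v w. keys \<delta> \<subseteq> sv_vars d \<and> v \<in> sv_vars d \<and> w \<in> sv_vars d \<and> below v w \<and>
     m = \<delta> + (single v 1 + single w 1) \<and>
     m' = \<delta> + (single (entry_index (hrow v) (hcol w)) 1 + single (entry_index (hrow w) (hcol v)) 1))"

lemma entry_index_in_sv_vars:
  assumes "v \<in> sv_vars d" "w \<in> sv_vars d"
  shows "entry_index (hrow v) (hcol w) \<in> sv_vars d"
proof -
  have "hrow v div 2 \<le> d div 2" using hrow_bound[OF assms(1)]
    by (metis Suc_eq_plus1 less_Suc_eq_le less_mult_imp_div_less mult.commute)
  moreover have "hcol w div 2 \<le> d - d div 2" using hcol_bound[OF assms(2)]
    by (metis Suc_eq_plus1 less_Suc_eq_le less_mult_imp_div_less mult.commute)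
  moreover have "p mod 2 + q mod 2 \<le> 2" for p q :: nat by linarith
  ultimately show ?thesis by (auto simp: sv_vars_def entry_index_def)
qed

lemma entry_index_weight: "2 * fst (entry_index p q) + snd (entry_index p q) = p + q"
  unfolding entry_index_def fst_conv snd_conv
  by presburger

text \<open>Each index of an entry is a row part plus a column part, so exchanging the columns of
  two entries preserves the totals.\<close>

lemma hstep_same_weight: "hstep d m m' \<Longrightarrow> same_weight m m'"
proof -
  assume "hstep d m m'"
  then obtain \<delta> v w where *: "v \<in> sv_vars d" "w \<in> sv_vars d"
    "m = \<delta> + (single v 1 + single w 1)"
    "m' = \<delta> + (single (entry_index (hrow v) (hcol w)) 1 + single (entry_index (hrow w) (hcol v)) 1)"
    unfolding hstep_def by blast
  have coords: "fst u = hrow u div 2 + hcol u div 2" "snd u = hrow u mod 2 + hcol u mod 2"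
    if "u \<in> sv_vars d" for u
    using arg_cong[OF entry_index_hrow_hcol[OF that], of fst]
      arg_cong[OF entry_index_hrow_hcol[OF that], of snd]
    unfolding entry_index_def by simp_all
  have "fst v + fst w = fst (entry_index (hrow v) (hcol w)) + fst (entry_index (hrow w) (hcol v))"
    "snd v + snd w = snd (entry_index (hrow v) (hcol w)) + snd (entry_index (hrow w) (hcol v))"
    unfolding coords[OF *(1)] coords[OF *(2)] entry_index_def by simp_all
  then show ?thesis by (simp add: same_weight_def * wsum_add)
qed

lemma hstep_keys: "hstep d m m' \<Longrightarrow> keys m \<subseteq> sv_vars d \<and> keys m' \<subseteq> sv_vars d"
proof -
  assume "hstep d m m'"
  then obtain \<delta> v w where *: "keys \<delta> \<subseteq> sv_vars d" "v \<in> sv_vars d" "w \<in> sv_vars d"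
    "m = \<delta> + (single v 1 + single w 1)"
    "m' = \<delta> + (single (entry_index (hrow v) (hcol w)) 1 + single (entry_index (hrow w) (hcol v)) 1)"
    unfolding hstep_def by blast
  have "keys (\<delta> + (single a 1 + single b 1)) \<subseteq> sv_vars d"
    if "a \<in> sv_vars d" "b \<in> sv_vars d" for a b
    using that *(1) Poly_Mapping.keys_add[of \<delta> "single a 1 + single b 1"]
      Poly_Mapping.keys_add[of "single a 1" "single b (1::nat)"] by auto
  with *(2-) show ?thesis by (simp add: entry_index_in_sv_vars)
qed

text \<open>The base \<open>2 * i + j\<close> is the antidiagonal on which the indeterminate lies. A
  step replaces positions (p, q), (p + a, q + b) by (p, q + b), (p + a, q); this moves the
  antidiagonals closer together, and the sum of squares drops by 2 a b.\<close>

definition quadratic_weight :: "(nat \<times> nat) monomial \<Rightarrow> nat" where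
  "quadratic_weight = wsum (\<lambda>v. (2 * fst v + snd v)\<^sup>2)"

lemma hstep_decreases: "hstep d m m' \<Longrightarrow> quadratic_weight m' < quadratic_weight m"
proof -
  assume "hstep d m m'"
  then obtain \<delta> v w where *: "v \<in> sv_vars d" "w \<in> sv_vars d" "below v w"
    "m = \<delta> + (single v 1 + single w 1)"
    "m' = \<delta> + (single (entry_index (hrow v) (hcol w)) 1 + single (entry_index (hrow w) (hcol v)) 1)"
    unfolding hstep_def by blast
  have pos: "2 * fst v + snd v = hrow v + hcol v" for v
    using hrow_plus_hcol[of "fst v" "snd v"] by simp
  obtain a b where ab: "hrow w = hrow v + a" "hcol w = hcol v + b" "a > 0" "b > 0"
    using *(3) unfolding below_def by (metis less_imp_add_positive)
  have "(hrow v + hcol w)\<^sup>2 + (hrow w + hcol v)\<^sup>2 < (hrow v + hcol v)\<^sup>2 + (hrow w + hcol w)\<^sup>2"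
    using ab(3,4) unfolding ab(1,2) power2_eq_square by (simp add: algebra_simps)
  then show ?thesis
    unfolding quadratic_weight_def *(4,5) wsum_add wsum_single entry_index_weight
    by (simp only: pos)
qed

lemma hstep_exists:
  assumes "keys m \<subseteq> sv_vars d" "\<not> standard m"
  shows "\<exists>m'. hstep d m m'"
proof -
  obtain v w where vw: "v \<in> keys m" "w \<in> keys m" "below v w"
    using assms(2) by (auto simp: standard_def)
  then have "v \<noteq> w" by auto
  let ?\<delta> = "m - (single v 1 + single w 1)"
  have "m = ?\<delta> + (single v 1 + single w 1)"
    using vw \<open>v \<noteq> w\<close> by (auto intro!: poly_mapping_eqI simp: lookup_add lookup_minus lookup_single
          when_def in_keys_iff)
  moreover have "keys ?\<delta> \<subseteq> keys m" by (auto simp: in_keys_iff lookup_minus)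
  ultimately show ?thesis unfolding hstep_def using vw assms(1) by blast
qed

lemma normal_form_exists:
  assumes "keys m \<subseteq> sv_vars d"
  shows "\<exists>s. (hstep d)\<^sup>*\<^sup>* m s \<and> standard s"
  using assms
proof (induction "quadratic_weight m" arbitrary: m rule: less_induct)
  case less
  show ?case
  proof (cases "standard m")
    case False
    then obtain m' where m': "hstep d m m'" using hstep_exists less.prems by blast
    then obtain s where "(hstep d)\<^sup>*\<^sup>* m' s" "standard s"
      using less.hyps[OF hstep_decreases] hstep_keys by blast
    with m' show ?thesis by (meson converse_rtranclp_into_rtranclp)
  qed blast
qed

definition nform :: "nat \<Rightarrow> (nat \<times> nat) monomial \<Rightarrow> (nat \<times> nat) monomial" where
  "nform d m = (SOME s. (hstep d)\<^sup>*\<^sup>* m s \<and> standard s)"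

lemma nform:
  assumes "keys m \<subseteq> sv_vars d"
  shows "(hstep d)\<^sup>*\<^sup>* m (nform d m)" "standard (nform d m)"
  unfolding nform_def using someI_ex[OF normal_form_exists[OF assms]] by auto

lemma hsteps_same_weight: "(hstep d)\<^sup>*\<^sup>* m m' \<Longrightarrow> same_weight m m'"
  by (induction rule: rtranclp_induct) (auto intro: hstep_same_weight same_weight_trans)

lemma hsteps_keys: "(hstep d)\<^sup>*\<^sup>* m m' \<Longrightarrow> keys m \<subseteq> sv_vars d \<Longrightarrow> keys m' \<subseteq> sv_vars d"
  by (induction rule: rtranclp_induct) (use hstep_keys in auto)

lemma nform_same_weight: "keys m \<subseteq> sv_vars d \<Longrightarrow> same_weight m (nform d m)"
  using nform(1) hsteps_same_weight by blast

lemma nform_keys: "keys m \<subseteq> sv_vars d \<Longrightarrow> keys (nform d m) \<subseteq> sv_vars d"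
  using nform(1) hsteps_keys by blast

text \<open>Steps preserve the weight and each weight has at most one standard monomial. The
  arbitrary choice in \<open>nform\<close> is thereby harmless: the normal form is a complete
  invariant of the weight.\<close>

lemma nform_eq_iff:
  assumes "keys m \<subseteq> sv_vars d" "keys n \<subseteq> sv_vars d"
  shows "nform d m = nform d n \<longleftrightarrow> same_weight m n"
proof
  assume "nform d m = nform d n"
  then show "same_weight m n"
    using nform_same_weight[OF assms(1)] nform_same_weight[OF assms(2)]
    by (simp add: same_weight_def)
next
  assume "same_weight m n"
  then have "same_weight (nform d m) (nform d n)"
    using nform_same_weight[OF assms(1)] nform_same_weight[OF assms(2)]
    by (simp add: same_weight_def)
  then show "nform d m = nform d n"
    using nform(2) nform_keys assms by (intro standard_unique)
qed

section \<open>Minors of the block Hankel matrix\<close>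

lemma block_hankel_index:
  assumes "p < 2 * (k + 1)" "q < 2 * (d - k + 1)"
  shows "block_hankel d k $$ (p, q)
    = (Var (entry_index p q) :: (nat \<times> nat, 'a::comm_ring_1) mpoly)"
proof -
  have "sym_block i $$ (a, b) = (Var (i, a + b) :: (nat \<times> nat, 'a) mpoly)" if "a < 2" "b < 2" for i a b
    using that unfolding less_2_cases_iff by (auto simp: sym_block_def mat_of_rows_list_def numeral_2_eq_2)
  then show ?thesis using assms by (simp add: block_hankel_def entry_index_def)
qed

lemma dim_block_hankel [simp]:
  "dim_row (block_hankel d k) = 2 * (k + 1)" "dim_col (block_hankel d k) = 2 * (d - k + 1)"
  by (simp_all add: block_hankel_def)

lemma entry_index_bound:
  assumes "p < 2 * (k + 1)" "q < 2 * (d - k + 1)" "k \<le> d"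
  shows "entry_index p q \<in> sv_vars d"
proof -
  have "p div 2 < k + 1" "q div 2 < d - k + 1"
    using assms by (simp_all add: less_mult_imp_div_less mult.commute)
  moreover have "p mod 2 + q mod 2 \<le> 2" by linarith
  ultimately show ?thesis using assms(3) by (auto simp: entry_index_def sv_vars_def)
qed

lemma submatrix_block_hankel:
  assumes "R \<subseteq> {..<2 * (k + 1)}" "C \<subseteq> {..<2 * (d - k + 1)}" "card R = n" "card C = n"
  shows "submatrix (block_hankel d k) R C
    = mat n n (\<lambda>(s, t). Var (entry_index (pick R s) (pick C t)))"
proof -
  have "{i. i < 2 * (k + 1) \<and> i \<in> R} = R" "{i. i < 2 * (d - k + 1) \<and> i \<in> C} = C"
    using assms by auto
  moreover have "pick R s < 2 * (k + 1)" "pick C s < 2 * (d - k + 1)" if "s < n" for s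
    using pick_in_set_le[of s R] pick_in_set_le[of s C] that assms by auto
  ultimately show ?thesis
    using assms by (intro eq_matI) (auto simp: dim_submatrix submatrix_index block_hankel_index)
qed

lemma polys_det:
  assumes "M \<in> carrier_mat n n" "\<And>s t. s < n \<Longrightarrow> t < n \<Longrightarrow> M $$ (s, t) \<in> polys V"
  shows "det M \<in> polys V"
proof -
  have "signof \<pi> \<in> polys V" for \<pi> :: "nat \<Rightarrow> nat"
    by (auto simp: sign_def polys_uminus)
  then show ?thesis
    unfolding det_def'[OF assms(1)] using assms(2)
    by (intro polys_sum polys_mult polys_prod) (auto simp: permutes_in_image)
qed

lemma minors_polys:
  assumes "k \<le> d"
  shows "minors n (block_hankel d k) \<subseteq> polys (sv_vars d)"
proof
  fix p :: "(nat \<times> nat, 'a::comm_ring_1) mpoly"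
  assume "p \<in> minors n (block_hankel d k)"
  then obtain R C where RC: "R \<subseteq> {..<2 * (k + 1)}" "C \<subseteq> {..<2 * (d - k + 1)}"
    "card R = n" "card C = n" "p = det (submatrix (block_hankel d k) R C)"
    unfolding minors_def by auto
  show "p \<in> polys (sv_vars d)"
    unfolding RC(5) submatrix_block_hankel[OF RC(1-4)]
  proof (rule polys_det)
    fix s t assume st: "s < n" "t < n"
    then have "entry_index (pick R s) (pick C t) \<in> sv_vars d"
      using pick_in_set_le[of s R] pick_in_set_le[of t C] RC assms
      by (intro entry_index_bound) auto
    then show "mat n n (\<lambda>(s, t). Var (entry_index (pick R s) (pick C t))) $$ (s, t) \<in> polys (sv_vars d)"
      using st by (simp add: polys_Var)
  qed simp
qed

lemma det_2x2: "det (mat 2 2 f) = f (0, 0) * f (1, 1) - f (0, 1) * f (1, 0)"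
  for f :: "nat \<times> nat \<Rightarrow> 'a::comm_ring_1"
proof -
  have 1: "det (mat_delete (mat 2 2 f) 0 j) = f (1, 1 - j)" if "j < 2" for j
    using that by (subst det_single) (auto simp: mat_delete_def less_2_cases_iff)
  have "{..<2} = {0, 1::nat}" by auto
  have "det (mat 2 2 f) = (\<Sum>j<2. mat 2 2 f $$ (0, j) * cofactor (mat 2 2 f) 0 j)"
    by (rule laplace_expansion_row) auto
  also have "\<dots> = f (0, 0) * f (1, 1) - f (0, 1) * f (1, 0)"
    using 1[of 0] 1[of 1] \<open>{..<2} = {0, 1::nat}\<close> by (simp add: cofactor_def)
  finally show ?thesis .
qed

text \<open>Taking the preferred positions of the elements of a chain as diagonal.\<close>

lemma chain_minor:
  assumes C: "C \<subseteq> sv_vars d" "chain C"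
  shows "hrow ` C \<subseteq> {..<2 * (d div 2 + 1)}" "hcol ` C \<subseteq> {..<2 * (d - d div 2 + 1)}"
    "card (hrow ` C) = card C" "card (hcol ` C) = card C"
    "bij_betw (\<lambda>s. entry_index (pick (hrow ` C) s) (pick (hcol ` C) s)) {..<card C} C"
proof -
  have inj: "inj_on hrow C" "inj_on hcol C"
    using C(2) unfolding chain_def below_def inj_on_def by (metis less_irrefl)+
  show "hrow ` C \<subseteq> {..<2 * (d div 2 + 1)}" "hcol ` C \<subseteq> {..<2 * (d - d div 2 + 1)}"
    using hrow_bound hcol_bound C(1) by blast+
  show card: "card (hrow ` C) = card C" "card (hcol ` C) = card C"
    using inj by (simp_all add: card_image)
  \<comment> \<open>The rank of \<open>c\<close> in the chain. Rows and columns both increase along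
    the chain, so \<open>c\<close> has the same rank among the rows as among the columns and sits on
    the diagonal of the minor.\<close>
  define idx where "idx c = card {b \<in> C. below b c}" for c
  have less: "hrow b < hrow c \<longleftrightarrow> below b c" "hcol b < hcol c \<longleftrightarrow> below b c"
    if "b \<in> C" "c \<in> C" for b c
    using that C(2) unfolding chain_def below_def by (metis less_asym less_irrefl)+
  have pick: "pick (hrow ` C) (idx c) = hrow c" "pick (hcol ` C) (idx c) = hcol c" if "c \<in> C" for c
  proof -
    have "{a \<in> hrow ` C. a < hrow c} = hrow ` {b \<in> C. below b c}"
      "{a \<in> hcol ` C. a < hcol c} = hcol ` {b \<in> C. below b c}"
      using less[OF _ that] by auto
    then have "card {a \<in> hrow ` C. a < hrow c} = idx c" "card {a \<in> hcol ` C. a < hcol c} = idx c"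
      unfolding idx_def using inj by (auto intro!: card_image intro: inj_on_subset)
    then show "pick (hrow ` C) (idx c) = hrow c" "pick (hcol ` C) (idx c) = hcol c"
      using pick_card_in_set[of "hrow c" "hrow ` C"] pick_card_in_set[of "hcol c" "hcol ` C"] that
      by auto
  qed
  have fin: "finite C" using C(1) by (rule finite_subset) (simp add: sv_vars_def)
  have idx_less: "idx c < card C" if "c \<in> C" for c
  proof -
    have "c \<notin> {b \<in> C. below b c}" by simp
    with that have "{b \<in> C. below b c} \<subset> C" by blast
    with fin show ?thesis unfolding idx_def by (rule psubset_card_mono)
  qed
  let ?e = "\<lambda>s. entry_index (pick (hrow ` C) s) (pick (hcol ` C) s)"
  have e: "?e (idx c) = c" if "c \<in> C" for c
    using that C(1) by (auto simp: pick entry_index_hrow_hcol)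
  have "inj_on idx C" by (rule inj_on_inverseI[of _ ?e]) (rule e)
  moreover have "idx ` C \<subseteq> {..<card C}" using idx_less by auto
  ultimately have "idx ` C = {..<card C}"
    by (intro card_subset_eq) (auto simp: card_image)
  with \<open>inj_on idx C\<close> have "bij_betw idx C {..<card C}" by (simp add: bij_betw_def)
  then show "bij_betw ?e {..<card C} C"
    unfolding \<open>idx ` C = {..<card C}\<close>[symmetric]
    by (intro bij_betw_byWitness[where f' = idx]) (auto simp only: e image_iff)
qed

lemma diagonal_chain_minor:
  assumes C: "C \<subseteq> sv_vars d" "chain C"
  shows "prod_list (diag_mat (submatrix (block_hankel d (d div 2)) (hrow ` C) (hcol ` C)))
    = (single (\<Sum>c\<in>C. single c 1) 1 :: (nat \<times> nat, 'a::comm_ring_1) mpoly)"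
proof -
  let ?e = "\<lambda>s. entry_index (pick (hrow ` C) s) (pick (hcol ` C) s)"
  have "prod_list (diag_mat (submatrix (block_hankel d (d div 2)) (hrow ` C) (hcol ` C)))
      = (\<Prod>s\<in>{..<card C}. Var (?e s) :: (nat \<times> nat, 'a) mpoly)"
    unfolding submatrix_block_hankel[OF chain_minor(1-4)[OF C]] prod_list_diag_prod
    by (intro prod.cong) auto
  also have "\<dots> = (\<Prod>c\<in>C. Var c)"
    using chain_minor(5)[OF C] by (rule prod.reindex_bij_betw)
  finally show ?thesis by (simp add: Var_def prod_single_1)
qed

text \<open>For suitable values \<open>h\<close> the minor does not vanish: the value at the top left corner occurs
  nowhere else in the matrix, and its cofactor is nonzero by induction.\<close>

lemma hankel_minor_nonzero:
  fixes p q :: "nat \<Rightarrow> nat"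
  assumes "\<And>s t. s < t \<Longrightarrow> t < n \<Longrightarrow> p s < p t" "\<And>s t. s < t \<Longrightarrow> t < n \<Longrightarrow> q s < q t"
  shows "\<exists>h :: nat \<Rightarrow> 'a::comm_ring_1. det (mat n n (\<lambda>(s, t). h (p s + q t))) \<noteq> 0"
  using assms
proof (induction n arbitrary: p q)
  case 0
  have "det (mat 0 0 (\<lambda>(s, t). h (p s + q t))) = 1" for h :: "nat \<Rightarrow> 'a"
    by (rule det_dim_zero) simp
  then show ?case by simp
next
  case (Suc n)
  have "\<exists>h :: nat \<Rightarrow> 'a. det (mat n n (\<lambda>(s, t). h (p (Suc s) + q (Suc t)))) \<noteq> 0"
    using Suc.prems by (intro Suc.IH) auto
  then obtain h :: "nat \<Rightarrow> 'a"
    where h: "det (mat n n (\<lambda>(s, t). h (p (Suc s) + q (Suc t)))) \<noteq> 0" by blast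
  \<comment> \<open>Only the corner varies with \<open>x\<close>. The values 0 and 1 are compared
    because their difference 1 leaves exactly the cofactor of the corner, so the two determinants
    cannot both vanish.\<close>
  define M where "M x = mat (Suc n) (Suc n) (\<lambda>(s, t). (h(p 0 + q 0 := x)) (p s + q t))" for x
  have ge: "p 0 \<le> p s" "q 0 \<le> q s" if "s < Suc n" for s
    using Suc.prems(1)[of 0 s] Suc.prems(2)[of 0 s] that by (cases "s = 0"; force)+
  have new: "p s + q t \<noteq> p 0 + q 0" if "s < Suc n" "t < Suc n" "0 < s \<or> 0 < t" for s t
    using Suc.prems(1)[of 0 s] Suc.prems(2)[of 0 t] ge[of s] ge[of t] that by fastforce
  have del: "mat_delete (M x) 0 t = mat_delete (M y) 0 t" for x y t
    using new by (intro eq_matI) (auto simp: M_def mat_delete_def)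
  have corner: "mat_delete (M x) 0 0 = mat n n (\<lambda>(s, t). h (p (Suc s) + q (Suc t)))" for x
    using new by (intro eq_matI) (auto simp: M_def mat_delete_def)
  have "det (M x) = M x $$ (0, 0) * cofactor (M x) 0 0
      + (\<Sum>t<n. M x $$ (0, Suc t) * cofactor (M x) 0 (Suc t))" for x
    by (subst laplace_expansion_row[of _ "Suc n" 0])
      (auto simp: M_def sum.lessThan_Suc_shift simp del: sum.lessThan_Suc)
  moreover have "M x $$ (0, Suc t) = M y $$ (0, Suc t)" if "t < n" for x y t
    using that new[of 0 "Suc t"] by (auto simp: M_def)
  moreover have cof: "cofactor (M x) 0 t = cofactor (M y) 0 t" for x y t
    unfolding cofactor_def del[of x t y] ..
  ultimately have "det (M x) = M x $$ (0, 0) * cofactor (M 1) 0 0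
      + (\<Sum>t<n. M 1 $$ (0, Suc t) * cofactor (M 1) 0 (Suc t))" for x
    by (metis (no_types, lifting) lessThan_iff sum.cong)
  from this[of 0] this[of 1]
  have "det (M 1) - det (M 0) = (M 1 $$ (0, 0) - M 0 $$ (0, 0)) * cofactor (M 1) 0 0"
    by (simp add: left_diff_distrib)
  also have "\<dots> = det (mat n n (\<lambda>(s, t). h (p (Suc s) + q (Suc t))))"
    unfolding cofactor_def corner by (simp add: M_def)
  finally have "det (M 1) \<noteq> 0 \<or> det (M 0) \<noteq> 0" using h by force
  then show ?case unfolding M_def by blast
qed

text \<open>The specialisation of x_ij to \<open>h (2 * i + j)\<close> turns the block Hankel matrix
  into an ordinary Hankel matrix. Nonvanishing is needed because \<open>initial_monomial\<close> of
  zero is an unspecified value and generators of initial ideals come from nonzero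
  polynomials.\<close>

lemma chain_minor_nonzero:
  assumes C: "C \<subseteq> sv_vars d" "chain C"
  shows "det (submatrix (block_hankel d (d div 2)) (hrow ` C) (hcol ` C))
    \<noteq> (0 :: (nat \<times> nat, 'a::comm_ring_1) mpoly)"
proof
  let ?R = "hrow ` C" and ?C = "hcol ` C" and ?n = "card C"
  assume 0: "det (submatrix (block_hankel d (d div 2)) ?R ?C)
    = (0 :: (nat \<times> nat, 'a::comm_ring_1) mpoly)"
  have "\<exists>h :: nat \<Rightarrow> 'a. det (mat ?n ?n (\<lambda>(s, t). h (pick ?R s + pick ?C t))) \<noteq> 0"
    using chain_minor(3,4)[OF C] by (intro hankel_minor_nonzero pick_mono_le) auto
  then obtain h :: "nat \<Rightarrow> 'a"
    where h: "det (mat ?n ?n (\<lambda>(s, t). h (pick ?R s + pick ?C t))) \<noteq> 0" by blast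
  let ?\<sigma> = "\<lambda>v. h (2 * fst v + snd v)"
  have "map_mat (poly_subst id ?\<sigma>) (mat ?n ?n (\<lambda>(s, t). Var (entry_index (pick ?R s) (pick ?C t))))
      = mat ?n ?n (\<lambda>(s, t). h (pick ?R s + pick ?C t))"
    by (intro eq_matI) (auto simp: entry_index_weight)
  moreover have "poly_subst id ?\<sigma> (det (submatrix (block_hankel d (d div 2)) ?R ?C)) = 0"
    unfolding 0 by simp
  ultimately show False
    using h unfolding submatrix_block_hankel[OF chain_minor(1-4)[OF C]] subst_id.ps_det by simp
qed


section \<open>The parametrisation of the secant varieties\<close>

lemma meval_power: "meval (\<lambda>v. a ^ g v) m = a ^ wsum g m"
  by (simp add: meval_def wsum_def power_sum power_mult[symmetric] mult.commute)

lemma meval_mult: "meval (\<lambda>v. \<sigma> v * \<tau> v) m = meval \<sigma> m * meval \<tau> m"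
  by (simp add: meval_def power_mult_distrib prod.distrib)

lemma Var_power: "Var v ^ n = (single (single v n) 1 :: ('v, 'a::comm_ring_1) mpoly)"
  using meval_Var[of "single v n"] by simp

text \<open>The parameters t, u, v of the \<open>l\<close>-th point are the indeterminates 3 l, 3 l
  + 1, 3 l + 2; this is the exponent vector of the image of \<open>m\<close>.\<close>

definition pwt :: "nat \<Rightarrow> (nat \<times> nat) monomial \<Rightarrow> nat monomial" where
  "pwt l m = single (3 * l) (wsum (\<lambda>_. 1) m) + single (3 * l + 1) (wsum fst m)
     + single (3 * l + 2) (wsum snd m)"

text \<open>The monomial \<open>t u\<^sup>i v\<^sup>j\<close> in the \<open>l\<close>-th triple of parameters.\<close>

definition xpt :: "nat \<Rightarrow> nat \<times> nat \<Rightarrow> (nat, 'a::comm_ring_1) mpoly" where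
  "xpt l v = Var (3 * l) ^ 1 * Var (3 * l + 1) ^ fst v * Var (3 * l + 2) ^ snd v"

definition secpt :: "nat \<Rightarrow> nat \<times> nat \<Rightarrow> (nat, 'a::comm_ring_1) mpoly" where
  "secpt r v = (\<Sum>l<r. xpt l v)"

definition secant_kernel :: "nat \<Rightarrow> nat \<Rightarrow> (nat \<times> nat, 'a::comm_ring_1) mpoly set" where
  "secant_kernel d r = {p \<in> polys (sv_vars d). poly_subst Const (secpt r) p = 0}"

text \<open>The exponent 1 in \<open>xpt\<close> lets \<open>meval_power\<close> treat the three
  parameters alike, with the constant 1 as weight of the first.\<close>

lemma meval_xpt: "meval (xpt l) m = single (pwt l m) 1"
proof -
  have "meval (xpt l) m = meval (\<lambda>v. Var (3 * l) ^ 1 * Var (3 * l + 1) ^ fst v * Var (3 * l + 2) ^ snd v) m"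
    by (simp add: xpt_def[abs_def])
  then show ?thesis
    unfolding meval_mult meval_power unfolding Var_power by (simp add: mult_single pwt_def)
qed

lemma xpt_eq: "xpt l v = single (pwt l (single v 1)) 1"
  using meval_xpt[of l "single v 1"] by simp

lemma pwt_0 [simp]: "pwt l 0 = 0"
  by (simp add: pwt_def)

lemma pwt_add: "pwt l (m + n) = pwt l m + pwt l n"
  by (simp add: pwt_def wsum_add single_add ac_simps)

lemma lookup_pwt:
  "lookup (pwt l m) (3 * k) = (if k = l then wsum (\<lambda>_. 1) m else 0)"
  "lookup (pwt l m) (3 * k + 1) = (if k = l then wsum fst m else 0)"
  "lookup (pwt l m) (3 * k + 2) = (if k = l then wsum snd m else 0)"
proof -
  have "3 * l + 1 \<noteq> 3 * k" "3 * l + 2 \<noteq> 3 * k" "3 * l \<noteq> 3 * k + 1" "3 * l + 2 \<noteq> 3 * k + 1"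
    "3 * l \<noteq> 3 * k + 2" "3 * l + 1 \<noteq> 3 * k + 2" by presburger+
  then show "lookup (pwt l m) (3 * k) = (if k = l then wsum (\<lambda>_. 1) m else 0)"
    "lookup (pwt l m) (3 * k + 1) = (if k = l then wsum fst m else 0)"
    "lookup (pwt l m) (3 * k + 2) = (if k = l then wsum snd m else 0)"
    by (simp_all add: pwt_def lookup_add lookup_single when_def)
qed

lemma pwt_eq_iff: "pwt l m = pwt l n \<longleftrightarrow> same_weight m n"
proof
  assume "pwt l m = pwt l n"
  with lookup_pwt[of l m l] lookup_pwt[of l n l] show "same_weight m n"
    by (simp add: same_weight_def)
qed (simp add: pwt_def same_weight_def)

text \<open>The coefficients of the image are the sums of the coefficients over the weight classes.
  The condition does not mention \<open>l\<close>, so all \<open>xpt l\<close> have the same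
  kernel.\<close>

lemma subst_xpt_eq_0_iff:
  "poly_subst Const (xpt l) p = 0 \<longleftrightarrow> (\<forall>n. (\<Sum>m\<in>{m\<in>keys p. same_weight m n}. lookup p m) = 0)"
proof -
  have ps: "poly_subst Const (xpt l) p = (\<Sum>m\<in>keys p. single (pwt l m) (lookup p m))"
    unfolding poly_subst_def meval_def[symmetric] by (simp add: meval_xpt Const_mult_single)
  have lk: "lookup (poly_subst Const (xpt l) p) k = (\<Sum>m\<in>{m\<in>keys p. pwt l m = k}. lookup p m)" for k
    unfolding ps lookup_sum lookup_single when_def by (simp add: sum.inter_filter)
  show ?thesis
  proof
    assume "poly_subst Const (xpt l) p = 0"
    then show "\<forall>n. (\<Sum>m\<in>{m\<in>keys p. same_weight m n}. lookup p m) = 0"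
      using lk[of "pwt l _"] by (simp add: pwt_eq_iff)
  next
    assume *: "\<forall>n. (\<Sum>m\<in>{m\<in>keys p. same_weight m n}. lookup p m) = 0"
    show "poly_subst Const (xpt l) p = 0"
    proof (rule poly_mapping_eqI)
      fix k
      show "lookup (poly_subst Const (xpt l) p) k = lookup 0 k"
      proof (cases "\<exists>n. pwt l n = k")
        case True
        then show ?thesis unfolding lk using * by (auto simp: pwt_eq_iff)
      next
        case False
        then have none: "{m\<in>keys p. pwt l m = k} = {}" by blast
        show ?thesis unfolding lk none by simp
      qed
    qed
  qed
qed

text \<open>Anything depending only on the weight may replace the monomials of a toric relation. It
  is applied with \<open>g\<close> a normal form and with \<open>g\<close> the value at a point of
  the variety.\<close>

lemma (in coeff_hom) weight_class_sum:
  assumes "\<And>n. (\<Sum>m\<in>{m\<in>keys p. same_weight m n}. lookup p m) = 0"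
    and "\<And>m n. m \<in> keys p \<Longrightarrow> n \<in> keys p \<Longrightarrow> same_weight m n \<Longrightarrow> g m = g n"
  shows "(\<Sum>m\<in>keys p. \<phi> (lookup p m) * g m) = 0"
proof -
  define w where "w m = (wsum (\<lambda>_. 1) m, wsum fst m, wsum snd m)" for m :: "(nat \<times> nat) monomial"
  have w: "w m = w n \<longleftrightarrow> same_weight m n" for m n by (simp add: w_def same_weight_def)
  have hom_sum: "\<phi> (sum f A) = (\<Sum>a\<in>A. \<phi> (f a))" for f :: "(nat \<times> nat) monomial \<Rightarrow> 'a" and A
    by (induction A rule: infinite_finite_induct) (simp_all add: hom_add)
  have "(\<Sum>m\<in>keys p. \<phi> (lookup p m) * g m)
      = (\<Sum>y\<in>w ` keys p. \<Sum>m\<in>{m\<in>keys p. w m = y}. \<phi> (lookup p m) * g m)"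
    by (rule sum.image_gen) simp
  also have "\<dots> = 0"
  proof (rule sum.neutral, rule ballI)
    fix y assume "y \<in> w ` keys p"
    then obtain n where n: "n \<in> keys p" "y = w n" by blast
    have class_eq: "{m\<in>keys p. w m = y} = {m\<in>keys p. same_weight m n}"
      by (simp add: n(2) w)
    have const: "g m = g n" if "m \<in> {m\<in>keys p. same_weight m n}" for m
      by (rule assms(2)) (use that n(1) in simp_all)
    have "(\<Sum>m\<in>{m\<in>keys p. w m = y}. \<phi> (lookup p m) * g m)
        = (\<Sum>m\<in>{m\<in>keys p. same_weight m n}. \<phi> (lookup p m) * g n)"
      by (rule sum.cong[OF class_eq]) (simp only: const)
    also have "\<dots> = \<phi> (\<Sum>m\<in>{m\<in>keys p. same_weight m n}. lookup p m) * g n"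
      by (simp only: hom_sum sum_distrib_right)
    finally show "(\<Sum>m\<in>{m\<in>keys p. w m = y}. \<phi> (lookup p m) * g m) = 0"
      by (simp add: assms(1))
  qed
  finally show ?thesis .
qed

lemma secpt_1: "secpt 1 = xpt 0" "secpt (Suc 0) = xpt 0"
  by (simp_all add: secpt_def fun_eq_iff)

lemma secant_kernel_1_iff:
  "p \<in> secant_kernel d 1 \<longleftrightarrow> p \<in> polys (sv_vars d) \<and>
    (\<forall>n. (\<Sum>m\<in>{m\<in>keys p. same_weight m n}. lookup p m) = 0)"
  by (simp add: secant_kernel_def secpt_1 subst_xpt_eq_0_iff)

lemma secant_kernel_ideal: "ideal (secant_kernel d r) (poly_ring (sv_vars d))"
  unfolding secant_kernel_def by (rule subst_Const.ker_ideal)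

text \<open>At a point of the parametrisation the matrix is a sum of \<open>r\<close> matrices of rank one.\<close>

lemma minors_in_secant_kernel:
  assumes "k \<le> d"
  shows "minors (r + 1) (block_hankel d k) \<subseteq> secant_kernel d r"
proof
  fix p :: "(nat \<times> nat, 'a::comm_ring_1) mpoly"
  assume p: "p \<in> minors (r + 1) (block_hankel d k)"
  then obtain R C where RC: "R \<subseteq> {..<2 * (k + 1)}" "C \<subseteq> {..<2 * (d - k + 1)}"
    "card R = r + 1" "card C = r + 1" "p = det (submatrix (block_hankel d k) R C)"
    unfolding minors_def by auto
  let ?n = "r + 1"
  define f g where "f l a = (Var (3 * l) * Var (3 * l + 1) ^ (a div 2) * Var (3 * l + 2) ^ (a mod 2) :: (nat, 'a) mpoly)"
    and "g l b = (Var (3 * l + 1) ^ (b div 2) * Var (3 * l + 2) ^ (b mod 2) :: (nat, 'a) mpoly)" for l a b :: nat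
  define F where "F = mat ?n ?n (\<lambda>(s, l). f l (pick R s))"
  \<comment> \<open>The factorisation through rank \<open>r\<close> is padded to square matrices of
    size r + 1: the last row of \<open>G\<close> is zero, so its determinant vanishes.\<close>
  define G where "G = mat ?n ?n (\<lambda>(l, t). if l < r then g l (pick C t) else 0)"
  have "map_mat (poly_subst Const (secpt r)) (mat ?n ?n (\<lambda>(s, t). Var (entry_index (pick R s) (pick C t))))
      = F * G"
  proof (intro eq_matI)
    fix s t assume "s < dim_row (F * G)" "t < dim_col (F * G)"
    then have st: "s < ?n" "t < ?n" by (simp_all add: F_def G_def)
    have "(F * G) $$ (s, t) = (\<Sum>l<?n. f l (pick R s) * (if l < r then g l (pick C t) else 0))"
      using st by (simp add: F_def G_def scalar_prod_def lessThan_atLeast0)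
    also have "\<dots> = (\<Sum>l<r. f l (pick R s) * g l (pick C t))" by simp
    also have "\<dots> = secpt r (entry_index (pick R s) (pick C t))"
      unfolding secpt_def xpt_def entry_index_def f_def g_def
      by (intro sum.cong) (simp_all add: power_add mult_ac)
    finally show "map_mat (poly_subst Const (secpt r)) (mat ?n ?n (\<lambda>(s, t).
        Var (entry_index (pick R s) (pick C t)))) $$ (s, t) = (F * G) $$ (s, t)"
      using st by simp
  qed (simp_all add: F_def G_def)
  then have "poly_subst Const (secpt r) p = det (F * G)"
    unfolding RC(5) submatrix_block_hankel[OF RC(1-4)] subst_Const.ps_det by simp
  also have "\<dots> = det F * det G"
    by (rule det_mult[of _ ?n]) (simp_all add: F_def G_def)
  also have "det G = 0"
    by (subst laplace_expansion_row[of _ ?n r]) (auto simp: G_def)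
  finally have "poly_subst Const (secpt r) p = 0" by simp
  with p minors_polys[OF assms] show "p \<in> secant_kernel d r"
    by (auto simp: secant_kernel_def)
qed

section \<open>The prime ideal of the Segre-Veronese variety\<close>

lemma sv_ideal_ideal: "ideal (sv_ideal d) (poly_ring (sv_vars d))"
  unfolding sv_ideal_def by (intro Idl_ideal minors_polys) simp

lemma pair_chain: "below v w \<Longrightarrow> chain {v, w}"
  by (simp add: chain_def)

lemma chain_minor_pair:
  assumes "v \<in> sv_vars d" "w \<in> sv_vars d" "below v w"
  shows "det (submatrix (block_hankel d (d div 2)) (hrow ` {v, w}) (hcol ` {v, w}))
    = (single (single v 1 + single w 1) 1
     - single (single (entry_index (hrow v) (hcol w)) 1 + single (entry_index (hrow w) (hcol v)) 1) 1
       :: (nat \<times> nat, 'a::comm_ring_1) mpoly)"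
proof -
  have pick2: "pick {a, b} 0 = a" "pick {a, b} 1 = b" if "a < b" for a b :: nat
  proof -
    have "{c \<in> {a, b}. c < a} = {}" "{c \<in> {a, b}. c < b} = {a}" using that by auto
    then have "card {c \<in> {a, b}. c < a} = 0" "card {c \<in> {a, b}. c < b} = 1" by simp_all
    moreover have "pick {a, b} (card {c \<in> {a, b}. c < a}) = a"
      "pick {a, b} (card {c \<in> {a, b}. c < b}) = b"
      by (rule pick_card_in_set; simp)+
    ultimately show "pick {a, b} 0 = a" "pick {a, b} 1 = b" by (simp_all only:)
  qed
  have C: "{v, w} \<subseteq> sv_vars d" "chain {v, w}" using assms pair_chain by auto
  have "v \<noteq> w" using assms(3) by auto
  then have "card {v, w} = 2" by simp
  note S = submatrix_block_hankel[OF chain_minor(1-4)[OF C], unfolded this]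
  have "hrow v < hrow w" "hcol v < hcol w" using assms(3) by (simp_all add: below_def)
  with pick2 show ?thesis
    unfolding S det_2x2
    by (simp add: entry_index_hrow_hcol[OF assms(1)] entry_index_hrow_hcol[OF assms(2)] Var_def
        mult_single del: pick.simps)
qed

lemma hstep_in_sv_ideal:
  assumes "hstep d m m'"
  shows "(single m 1 - single m' 1 :: (nat \<times> nat, 'a::comm_ring_1) mpoly) \<in> sv_ideal d"
proof -
  from assms obtain \<delta> v w where *: "keys \<delta> \<subseteq> sv_vars d" "v \<in> sv_vars d" "w \<in> sv_vars d" "below v w"
    "m = \<delta> + (single v 1 + single w 1)"
    "m' = \<delta> + (single (entry_index (hrow v) (hcol w)) 1 + single (entry_index (hrow w) (hcol v)) 1)"
    unfolding hstep_def by blast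
  have C: "{v, w} \<subseteq> sv_vars d" "chain {v, w}" using *(2-4) pair_chain by auto
  have "v \<noteq> w" using *(4) by auto
  then have c2: "card {v, w} = 2" by simp
  have "det (submatrix (block_hankel d (d div 2)) (hrow ` {v, w}) (hcol ` {v, w}))
      \<in> (minors 2 (block_hankel d (d div 2)) :: (nat \<times> nat, 'a) mpoly set)"
    unfolding minors_def using chain_minor(1-4)[OF C] c2 by fastforce
  then have "det (submatrix (block_hankel d (d div 2)) (hrow ` {v, w}) (hcol ` {v, w}))
      \<in> (sv_ideal d :: (nat \<times> nat, 'a) mpoly set)"
    unfolding sv_ideal_def by (intro Idl_self minors_polys div_le_dividend)
  then have "single \<delta> 1 * (single (single v 1 + single w 1) 1
     - single (single (entry_index (hrow v) (hcol w)) 1 + single (entry_index (hrow w) (hcol v)) 1) 1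
       :: (nat \<times> nat, 'a) mpoly) \<in> sv_ideal d"
    unfolding chain_minor_pair[OF *(2-4)]
    by (rule ideal_mult[OF sv_ideal_ideal]) (use *(1) in \<open>simp add: polys_single\<close>)
  then show ?thesis unfolding *(5,6) by (simp add: right_diff_distrib mult_single)
qed

lemma nform_in_sv_ideal:
  assumes "keys m \<subseteq> sv_vars d"
  shows "(single m 1 - single (nform d m) 1 :: (nat \<times> nat, 'a::comm_ring_1) mpoly) \<in> sv_ideal d"
  using nform(1)[OF assms]
proof (induction rule: rtranclp_induct)
  case base
  show ?case using ideal_0[OF sv_ideal_ideal] by simp
next
  case (step m' m'')
  from ideal_add[OF sv_ideal_ideal step.IH hstep_in_sv_ideal[OF step.hyps(2)]]
  show ?case by simp
qed

text \<open>Modulo the minors a polynomial becomes the combination \<open>?N\<close> of normal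
  forms. These are constant on weight classes, so for an element of the kernel everything
  cancels.\<close>

lemma sv_ideal_eq_secant_kernel:
  "sv_ideal d = (secant_kernel d 1 :: (nat \<times> nat, 'a::comm_ring_1) mpoly set)"
proof
  show "sv_ideal d \<subseteq> (secant_kernel d 1 :: (nat \<times> nat, 'a) mpoly set)"
    unfolding sv_ideal_def using minors_in_secant_kernel[of "d div 2" d 1]
    by (intro Idl_minimal secant_kernel_ideal) (simp add: numeral_2_eq_2)
  show "(secant_kernel d 1 :: (nat \<times> nat, 'a) mpoly set) \<subseteq> sv_ideal d"
  proof
    fix p :: "(nat \<times> nat, 'a) mpoly"
    assume "p \<in> secant_kernel d 1"
    then have p: "p \<in> polys (sv_vars d)"
      and w: "\<And>n. (\<Sum>m\<in>{m\<in>keys p. same_weight m n}. lookup p m) = 0"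
      unfolding secant_kernel_1_iff by blast+
    have V: "keys m \<subseteq> sv_vars d" if "m \<in> keys p" for m using p that by (simp add: polys_iff)
    let ?N = "\<Sum>m\<in>keys p. Const (lookup p m) * single (nform d m) 1"
    have "(\<Sum>m\<in>keys p. Const (lookup p m) * (single m 1 - single (nform d m) 1)) \<in> sv_ideal d"
      by (intro ideal_sum[OF sv_ideal_ideal] ideal_mult[OF sv_ideal_ideal] nform_in_sv_ideal V
          polys_Const)
    moreover have "?N = 0"
    proof (rule subst_Const.weight_class_sum[OF w])
      fix m n assume "m \<in> keys p" "n \<in> keys p" "same_weight m n"
      then have "nform d m = nform d n" using V nform_eq_iff by blast
      then show "single (nform d m) 1 = (single (nform d n) 1 :: (nat \<times> nat, 'a) mpoly)" by simp
    qed
    moreover have "p = (\<Sum>m\<in>keys p. Const (lookup p m) * single m 1)"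
      by (simp add: Const_mult_single flip: sum_single_lookup)
    ultimately show "p \<in> sv_ideal d"
      by (simp add: right_diff_distrib sum_subtractf)
  qed
qed

text \<open>It is the kernel of a homomorphism into an integral domain.\<close>

lemma sv_ideal_prime:
  "primeideal (sv_ideal d :: (nat \<times> nat, 'a::idom) mpoly set) (poly_ring (sv_vars d))"
proof (rule primeidealI)
  show "cring (poly_ring (sv_vars d) :: (nat \<times> nat, 'a) mpoly ring)" by (rule poly_ring_cring)
  have "(1 :: (nat \<times> nat, 'a) mpoly) \<notin> sv_ideal d"
    by (simp add: sv_ideal_eq_secant_kernel secant_kernel_def)
  moreover have "(1 :: (nat \<times> nat, 'a) mpoly) \<in> polys (sv_vars d)" by simp
  ultimately show "polys (sv_vars d) \<noteq> (sv_ideal d :: (nat \<times> nat, 'a) mpoly set)" by metis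
  show "p \<in> sv_ideal d \<or> q \<in> sv_ideal d"
    if "p \<in> polys (sv_vars d)" "q \<in> polys (sv_vars d)" "p \<otimes>\<^bsub>poly_ring (sv_vars d)\<^esub> q \<in> sv_ideal d"
    for p q :: "(nat \<times> nat, 'a) mpoly"
    using that by (auto simp: sv_ideal_eq_secant_kernel secant_kernel_def subst_Const.ps_mult)
qed (rule sv_ideal_ideal)

text \<open>\<open>toric_map\<close> and \<open>xpt 0\<close> differ by the names of the three
  parameters. Renamings in both directions show that they vanish on the same polynomials.\<close>

lemma sv_ideal_eq_toric: "sv_ideal d = (toric_ideal d :: (nat \<times> nat, 'a::comm_ring_1) mpoly set)"
proof -
  define to :: "toric_var \<Rightarrow> nat" where "to x = (case x of TT \<Rightarrow> 0 | UU \<Rightarrow> 1 | VV \<Rightarrow> 2)" for x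
  define from' :: "nat \<Rightarrow> toric_var" where "from' k = (if k = 0 then TT else if k = 1 then UU else VV)" for k
  have "poly_subst Const (xpt 0) p = poly_subst Const (\<lambda>x. Var (to x)) (toric_map p)"
    for p :: "(nat \<times> nat, 'a) mpoly"
    unfolding toric_map_def subst_Const.ps_comp
    by (rule arg_cong[of _ _ "\<lambda>\<sigma>. poly_subst Const \<sigma> p"])
      (auto simp: fun_eq_iff xpt_def to_def numeral_2_eq_2 subst_Const.ps_mult subst_Const.ps_power)
  moreover have "toric_map p = poly_subst Const (\<lambda>k. Var (from' k)) (poly_subst Const (xpt 0) p)"
    for p :: "(nat \<times> nat, 'a) mpoly"
    unfolding toric_map_def subst_Const.ps_comp
    by (rule arg_cong[of _ _ "\<lambda>\<sigma>. poly_subst Const \<sigma> p"])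
      (auto simp: fun_eq_iff xpt_def from'_def numeral_2_eq_2 subst_Const.ps_mult subst_Const.ps_power)
  ultimately have "toric_map p = 0 \<longleftrightarrow> poly_subst Const (xpt 0) p = 0" for p :: "(nat \<times> nat, 'a) mpoly"
    by (metis subst_Const.ps_0)
  then show ?thesis
    by (auto simp: sv_ideal_eq_secant_kernel secant_kernel_def toric_ideal_def secpt_1)
qed

section \<open>Polynomials vanishing on the points of the variety\<close>

lemma infinite_alg_closed_field: "infinite (UNIV :: 'a::alg_closed_field set)"
proof
  assume fin: "finite (UNIV :: 'a set)"
  define P :: "'a poly" where "P = (\<Prod>a\<in>UNIV. [:- a, 1:]) + 1"
  have "degree (\<Prod>a\<in>(UNIV :: 'a set). [:- a, 1:]) = card (UNIV :: 'a set)"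
    by (subst degree_prod_eq_sum_degree) auto
  moreover have "card (UNIV :: 'a set) > 0" using fin by (simp add: card_gt_0_iff)
  ultimately have "degree P > 0" unfolding P_def by (simp add: degree_add_eq_left)
  then obtain x where "poly P x = 0" using alg_closed_imp_poly_has_root by blast
  moreover have "poly (\<Prod>a\<in>UNIV. [:- a, 1:]) x = 0"
    using fin by (simp add: poly_prod)
  ultimately show False by (simp add: P_def)
qed

text \<open>Substituting \<open>(z\<^bsup>N\<^sup>2\<^esup>, z\<^bsup>N\<^esup>, z)\<close> for the parameters separates the finitely many weights
  that occur in \<open>p\<close>.\<close>

lemma vanishing_imp_weight_sums:
  fixes p :: "(nat \<times> nat, 'a::alg_closed_field) mpoly"
  assumes "\<And>c t v. c \<noteq> 0 \<Longrightarrow> poly_subst id (\<lambda>w. c ^ 1 * t ^ fst w * v ^ snd w) p = 0"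
  shows "(\<Sum>m\<in>{m\<in>keys p. same_weight m n}. lookup p m) = 0"
proof (cases "\<exists>m\<in>keys p. same_weight m n")
  case True
  then obtain n' where n': "n' \<in> keys p" "same_weight n' n" by blast
  have same: "same_weight m n \<longleftrightarrow> same_weight m n'" for m
    using n'(2) by (simp add: same_weight_def)
  define N where "N = Suc (\<Sum>m\<in>keys p. wsum fst m + wsum snd m)"
  have N: "wsum fst m < N" "wsum snd m < N" if "m \<in> keys p" for m
    using member_le_sum[OF that, of "\<lambda>m. wsum fst m + wsum snd m"] by (auto simp: N_def)
  \<comment> \<open>The weight read as digits in base \<open>N\<close>. The last two digits are
    smaller than \<open>N\<close>; the leading one may be arbitrary.\<close>
  define e where "e m = (wsum (\<lambda>_. 1) m * N + wsum fst m) * N + wsum snd m" for m :: "(nat \<times> nat) monomial"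
  have e: "e m = e m' \<longleftrightarrow> same_weight m m'" if "m \<in> keys p" "m' \<in> keys p" for m m'
  proof -
    have dm: "x = x' \<and> y = y'" if "x * N + y = x' * N + y'" "y < N" "y' < N" for x x' y y'
      using arg_cong[OF that(1), of "\<lambda>x. x mod N"] arg_cong[OF that(1), of "\<lambda>x. x div N"] that(2,3)
      by simp
    show ?thesis
      using dm[of "wsum (\<lambda>_. 1) m * N + wsum fst m" "wsum snd m"
          "wsum (\<lambda>_. 1) m' * N + wsum fst m'" "wsum snd m'"]
        dm[of "wsum (\<lambda>_. 1) m" "wsum fst m" "wsum (\<lambda>_. 1) m'" "wsum fst m'"] N that
      by (auto simp: e_def same_weight_def)
  qed
  define Q where "Q = (\<Sum>m\<in>keys p. monom (lookup p m) (e m))"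
  have "poly Q z = 0" if "z \<noteq> 0" for z
  proof -
    have "poly_subst id (\<lambda>w. (z ^ (N * N)) ^ 1 * (z ^ N) ^ fst w * z ^ snd w) p = 0"
      using that by (intro assms) simp
    moreover have "meval (\<lambda>w. (z ^ (N * N)) ^ 1 * (z ^ N) ^ fst w * z ^ snd w) m = z ^ e m" for m
      unfolding meval_mult meval_power e_def
      by (simp add: power_mult[symmetric] power_add[symmetric] algebra_simps)
    ultimately show ?thesis
      unfolding poly_subst_def meval_def[symmetric] Q_def by (simp add: poly_sum poly_monom)
  qed
  \<comment> \<open>The point 0 is left out because the scalar \<open>c\<close>, here a power of
    \<open>z\<close>, must be nonzero.\<close>
  then have "UNIV - {0} \<subseteq> {z. poly Q z = 0}" by auto
  moreover have "infinite (UNIV - {0 :: 'a})" using infinite_alg_closed_field by simp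
  ultimately have "Q = 0" using poly_roots_finite[of Q] finite_subset by blast
  then have "0 = coeff Q (e n')" by simp
  also have "\<dots> = (\<Sum>m\<in>{m\<in>keys p. e m = e n'}. lookup p m)"
    unfolding Q_def by (simp add: coeff_sum sum.inter_filter)
  also have "{m\<in>keys p. e m = e n'} = {m\<in>keys p. same_weight m n}"
    using e n' same by auto
  finally show ?thesis by simp
next
  case False
  then have none: "{m\<in>keys p. same_weight m n} = {}" by blast
  show ?thesis unfolding none by simp
qed

lemma sv_ideal_eq_vanishing:
  "sv_ideal d = vanishing_ideal (sv_vars d) (segre_veronese d :: (nat \<times> nat \<Rightarrow> 'a::alg_closed_field) set)"
proof
  show "sv_ideal d \<subseteq> vanishing_ideal (sv_vars d) (segre_veronese d :: (nat \<times> nat \<Rightarrow> 'a) set)"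
  proof
    fix p :: "(nat \<times> nat, 'a) mpoly"
    assume "p \<in> sv_ideal d"
    then have p: "p \<in> polys (sv_vars d)"
      and w: "\<And>n. (\<Sum>m\<in>{m\<in>keys p. same_weight m n}. lookup p m) = 0"
      unfolding sv_ideal_eq_secant_kernel secant_kernel_1_iff by blast+
    have "poly_subst id x p = 0" if "x \<in> segre_veronese d" for x
    proof -
      obtain c s t u v where x: "x = (\<lambda>(i, j). c * (veronese d s t i * veronese 2 u v j))"
        using \<open>x \<in> segre_veronese d\<close> unfolding segre_veronese_def by blast
      have "x = (\<lambda>w. c ^ 1 * (s ^ (d - fst w) * t ^ fst w * (u ^ (2 - snd w) * v ^ snd w)))"
        unfolding x by (auto simp: veronese_def fun_eq_iff)
      then have m: "meval x m = c ^ wsum (\<lambda>_. 1) m * (s ^ wsum (\<lambda>w. d - fst w) m * t ^ wsum fst m *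
          (u ^ wsum (\<lambda>w. 2 - snd w) m * v ^ wsum snd m))" for m
        by (simp only: meval_mult meval_power)
      \<comment> \<open>Since i is at most d and j at most 2, the exponents of s and u are
        determined by the weight, and so is the value of the monomial.\<close>
      have compl: "wsum (\<lambda>w. d - fst w) m = d * wsum (\<lambda>_. 1) m - wsum fst m"
        "wsum (\<lambda>w. 2 - snd w) m = 2 * wsum (\<lambda>_. 1) m - wsum snd m" if "m \<in> keys p" for m
      proof -
        have V: "keys m \<subseteq> sv_vars d" using p that by (simp add: polys_iff)
        have "wsum (\<lambda>w. (d - fst w) + fst w) m = wsum (\<lambda>_. d * 1) m"
          "wsum (\<lambda>w. (2 - snd w) + snd w) m = wsum (\<lambda>_. 2 * 1) m"
          unfolding wsum_def using V by (auto intro!: sum.cong simp: sv_vars_def)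
        then show "wsum (\<lambda>w. d - fst w) m = d * wsum (\<lambda>_. 1) m - wsum fst m"
          "wsum (\<lambda>w. 2 - snd w) m = 2 * wsum (\<lambda>_. 1) m - wsum snd m"
          unfolding wsum_plus wsum_mult by linarith+
      qed
      have "(\<Sum>m\<in>keys p. id (lookup p m) * meval x m) = 0"
        by (rule subst_id.weight_class_sum[OF w]) (simp add: m compl same_weight_def)
      then show ?thesis by (simp add: poly_subst_def meval_def)
    qed
    with p show "p \<in> vanishing_ideal (sv_vars d) (segre_veronese d)"
      by (simp add: vanishing_ideal_def)
  qed
  show "vanishing_ideal (sv_vars d) (segre_veronese d :: (nat \<times> nat \<Rightarrow> 'a) set) \<subseteq> sv_ideal d"
  proof
    fix p :: "(nat \<times> nat, 'a) mpoly"
    assume p: "p \<in> vanishing_ideal (sv_vars d) (segre_veronese d)"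
    \<comment> \<open>The chart with s = u = 1 already suffices.\<close>
    have "poly_subst id (\<lambda>w. c ^ 1 * t ^ fst w * v ^ snd w) p = 0" if "c \<noteq> 0" for c t v
    proof -
      have "(\<lambda>w. c ^ 1 * t ^ fst w * v ^ snd w)
          = (\<lambda>(i, j). c * (veronese d 1 t i * veronese 2 1 v j))"
        by (auto simp: veronese_def fun_eq_iff mult.assoc)
      with that have "(\<lambda>w. c ^ 1 * t ^ fst w * v ^ snd w) \<in> segre_veronese d"
        unfolding segre_veronese_def by fastforce
      with p show ?thesis by (simp add: vanishing_ideal_def)
    qed
    then have "(\<Sum>m\<in>{m\<in>keys p. same_weight m n}. lookup p m) = 0" for n
      by (rule vanishing_imp_weight_sums)
    with p show "p \<in> sv_ideal d"
      unfolding sv_ideal_eq_secant_kernel secant_kernel_1_iff vanishing_ideal_def by blast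
  qed
qed

section \<open>Joins\<close>

lemma join_generators_polys:
  fixes I J :: "('v, 'a::comm_ring_1) mpoly set"
  assumes "I \<subseteq> polys V" "J \<subseteq> polys V"
  shows "rename CY ` I \<union> rename CZ ` J \<union> {Var (CX a) - Var (CY a) - Var (CZ a) | a. a \<in> V}
    \<subseteq> polys (CX ` V \<union> CY ` V \<union> CZ ` V)"
  using assms by (auto simp: rename_subst intro!: polys_subst polys_minus polys_Var)

text \<open>Such a \<sigma> kills all generators of the ideal that defines the join. Each upper
  bound on a join below comes from a suitable choice of \<sigma>.\<close>

lemma join_vanish:
  fixes I J :: "('v, 'a::comm_ring_1) mpoly set" and \<sigma> :: "'v copy \<Rightarrow> ('w, 'a) mpoly"
  assumes p: "p \<in> join_ideal V I J"
    and Y: "\<And>q. q \<in> I \<Longrightarrow> poly_subst Const (\<lambda>v. \<sigma> (CY v)) q = 0"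
    and Z: "\<And>q. q \<in> J \<Longrightarrow> poly_subst Const (\<lambda>v. \<sigma> (CZ v)) q = 0"
    and X: "\<And>v. v \<in> V \<Longrightarrow> \<sigma> (CX v) = \<sigma> (CY v) + \<sigma> (CZ v)"
    and IJ: "I \<subseteq> polys V" "J \<subseteq> polys V"
  shows "poly_subst Const (\<lambda>v. \<sigma> (CX v)) p = 0"
proof -
  let ?W = "CX ` V \<union> CY ` V \<union> CZ ` V"
  let ?G = "rename CY ` I \<union> rename CZ ` J \<union> {Var (CX a) - Var (CY a) - Var (CZ a) | a. a \<in> V}"
  have ren: "poly_subst Const \<sigma> (rename f q) = poly_subst Const (\<lambda>v. \<sigma> (f v)) q"
    for f and q :: "('v, 'a) mpoly"
    by (simp add: rename_subst subst_Const.ps_comp)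
  have "poly_subst Const \<sigma> q = 0" if "q \<in> ?G" for q
    using that Y Z X by (auto simp: ren subst_Const.ps_minus)
  with join_generators_polys[OF IJ] have "?G \<subseteq> {q \<in> polys ?W. poly_subst Const \<sigma> q = 0}"
    by blast
  from Idl_minimal[OF subst_Const.ker_ideal this] p
  have "poly_subst Const \<sigma> (rename CX p) = 0"
    unfolding join_ideal_def by blast
  then show ?thesis by (simp only: ren)
qed

text \<open>Modulo the linear generators x = y + z, so p(x) and p(y + z) agree, and it suffices to
  place p(y + z) in the ideal.\<close>

lemma join_memberI:
  fixes I J :: "('v, 'a::comm_ring_1) mpoly set"
  assumes p: "p \<in> polys V" and IJ: "I \<subseteq> polys V" "J \<subseteq> polys V"
    and A: "A = Idl\<^bsub>poly_ring (CX ` V \<union> CY ` V \<union> CZ ` V)\<^esub>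
      (rename CY ` I \<union> rename CZ ` J \<union> {Var (CX a) - Var (CY a) - Var (CZ a) | a. a \<in> V})"
    and mem: "poly_subst Const (\<lambda>v. Var (CY v) + Var (CZ v)) p \<in> A"
  shows "p \<in> join_ideal V I J"
proof -
  note G = join_generators_polys[OF IJ]
  have ideal_A: "ideal A (poly_ring (CX ` V \<union> CY ` V \<union> CZ ` V))"
    unfolding A using G by (rule Idl_ideal)
  have "poly_subst Const (\<lambda>v. Var (CX v)) p - poly_subst Const (\<lambda>v. Var (CY v) + Var (CZ v)) p \<in> A"
  proof (rule ideal_subst_diff[OF ideal_A p])
    fix v assume v: "v \<in> V"
    have "Var (CX v) - Var (CY v) - Var (CZ v) \<in> A"
      unfolding A by (rule Idl_self[OF G]) (use v in blast)
    then show "Var (CX v) - (Var (CY v) + Var (CZ v)) \<in> A"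
      by (simp add: diff_diff_add)
  qed (auto intro!: polys_Var polys_add)
  from ideal_add[OF ideal_A this mem] show ?thesis
    unfolding join_ideal_def using p A by (simp add: rename_subst)
qed

lemma meval_split_copies:
  fixes \<mu> :: "'v copy monomial"
  assumes "keys \<mu> \<subseteq> CY ` V \<union> CZ ` V"
  shows "meval \<sigma> \<mu> = meval (\<lambda>v. \<sigma> (CY v)) (Poly_Mapping.map_key CY \<mu>)
    * meval (\<lambda>v. \<sigma> (CZ v)) (Poly_Mapping.map_key CZ \<mu>)"
proof -
  let ?a = "Poly_Mapping.map_key CY \<mu>" and ?b = "Poly_Mapping.map_key CZ \<mu>"
  have inj: "inj CY" "inj CZ" by (auto simp: inj_on_def)
  have lk: "lookup ?a v = lookup \<mu> (CY v)" "lookup ?b v = lookup \<mu> (CZ v)" for v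
    by (simp_all add: map_key.rep_eq inj)
  have "keys \<mu> \<subseteq> CY ` keys ?a \<union> CZ ` keys ?b"
    using assms by (auto simp: in_keys_iff lk image_iff)
  then have "meval \<sigma> \<mu> = (\<Prod>x\<in>CY ` keys ?a \<union> CZ ` keys ?b. \<sigma> x ^ lookup \<mu> x)"
    by (intro meval_superset) auto
  also have "\<dots> = (\<Prod>x\<in>CY ` keys ?a. \<sigma> x ^ lookup \<mu> x) * (\<Prod>x\<in>CZ ` keys ?b. \<sigma> x ^ lookup \<mu> x)"
    by (intro prod.union_disjoint) auto
  also have "(\<Prod>x\<in>CY ` keys ?a. \<sigma> x ^ lookup \<mu> x) = meval (\<lambda>v. \<sigma> (CY v)) ?a"
    unfolding meval_def lk by (subst prod.reindex) (auto simp: inj_on_def)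
  also have "(\<Prod>x\<in>CZ ` keys ?b. \<sigma> x ^ lookup \<mu> x) = meval (\<lambda>v. \<sigma> (CZ v)) ?b"
    unfolding meval_def lk by (subst prod.reindex) (auto simp: inj_on_def)
  finally show ?thesis .
qed

lemma lookup_single_mult: "lookup (single a 1 * f) (a + k) = lookup f k"
  for f :: "('v, 'a::comm_ring_1) mpoly"
proof -
  have "single a 1 * f = (\<Sum>m\<in>keys f. single (a + m) (lookup f m))"
    by (subst (1) sum_single_lookup[of f]) (simp add: sum_distrib_left mult_single)
  then show ?thesis
    by (simp add: lookup_sum lookup_single when_def sum.delta in_keys_iff)
qed

lemma secpt_polys: "secpt r v \<in> polys {..<3 * r}"
  unfolding secpt_def xpt_def by (intro polys_sum polys_mult polys_power polys_Var) auto

text \<open>The parameters of \<open>xpt r\<close> do not occur in \<open>secpt r\<close>, so that polynomials in the latter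
  with distinct monomials of the former as coefficients are linearly independent.\<close>

lemma xpt_independent:
  fixes f :: "(nat \<times> nat) monomial \<Rightarrow> (nat, 'a::comm_ring_1) mpoly"
  assumes fin: "finite S" and std: "\<And>s. s \<in> S \<Longrightarrow> standard s \<and> keys s \<subseteq> sv_vars d"
    and f: "\<And>s. s \<in> S \<Longrightarrow> f s \<in> polys {..<3 * r}"
    and sum: "(\<Sum>s\<in>S. single (pwt r s) 1 * f s) = 0"
    and s: "s \<in> S"
  shows "f s = 0"
proof (rule ccontr)
  assume "f s \<noteq> 0"
  then obtain k where k: "k \<in> keys (f s)" by (metis keys_eq_empty ex_in_conv)
  have other: "lookup (single (pwt r s') 1 * f s') (pwt r s + k) = 0" if s': "s' \<in> S" "s' \<noteq> s" for s'
  proof (rule ccontr)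
    assume "lookup (single (pwt r s') 1 * f s') (pwt r s + k) \<noteq> 0"
    then have "pwt r s + k \<in> keys (single (pwt r s') 1 * f s')" by (simp add: in_keys_iff)
    then obtain k' where k': "k' \<in> keys (f s')" "pwt r s + k = pwt r s' + k'"
      using keys_mult[of "single (pwt r s') 1" "f s'"] by (auto split: if_splits)
    have out: "lookup \<kappa> x = 0" if "\<kappa> \<in> keys (f u)" "u \<in> S" "3 * r \<le> x" for \<kappa> u x
    proof -
      have "keys \<kappa> \<subseteq> {..<3 * r}" using f[OF that(2)] that(1) by (auto simp: polys_iff)
      with that(3) have "x \<notin> keys \<kappa>" by auto
      then show ?thesis by (simp add: in_keys_iff)
    qed
    \<comment> \<open>The exponents \<open>k\<close> and \<open>k'\<close> do not involve the
      \<open>r\<close>-th triple, so its exponents are those of \<open>pwt r\<close>, from which the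
      weights can be read.\<close>
    have "lookup (pwt r s) x = lookup (pwt r s') x" if "3 * r \<le> x" for x
      using arg_cong[OF k'(2), of "\<lambda>\<kappa>. lookup \<kappa> x"] out[OF k s that] out[OF k'(1) s'(1) that]
      by (simp add: lookup_add)
    from this[of "3 * r"] this[of "3 * r + 1"] this[of "3 * r + 2"]
    have "same_weight s s'" unfolding lookup_pwt by (simp add: same_weight_def)
    then have "s = s'" using std s s'(1) by (intro standard_unique) auto
    with s'(2) show False by simp
  qed
  have "0 = lookup (\<Sum>s\<in>S. single (pwt r s) 1 * f s) (pwt r s + k)" by (simp add: sum)
  also have "\<dots> = (\<Sum>s'\<in>S. if s' = s then lookup (f s) k else 0)"
    unfolding lookup_sum by (rule sum.cong) (auto simp: lookup_single_mult other)
  also have "\<dots> = lookup (f s) k" using fin s by simp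
  finally show False using k by (simp add: in_keys_iff)
qed

lemma sv_ideal_polys: "sv_ideal d \<subseteq> polys (sv_vars d)"
  by (rule ideal_subset_polys[OF sv_ideal_ideal])

lemma secant_kernel_polys: "secant_kernel d r \<subseteq> polys (sv_vars d)"
  by (rule ideal_subset_polys[OF secant_kernel_ideal])

text \<open>Reducing the \<open>y\<close>-part of a polynomial in the two copies \<open>y\<close>, \<open>z\<close> to standard monomials
  modulo \<open>I(y)\<close> makes its coefficients, which are polynomials in \<open>z\<close>, independent.\<close>

lemma two_copies_kernel:
  fixes Q :: "((nat \<times> nat) copy, 'a::comm_ring_1) mpoly" and d r :: nat
  defines "V \<equiv> sv_vars d"
  assumes Q: "Q \<in> polys (CY ` V \<union> CZ ` V)"
    and \<theta>: "\<And>v. \<theta> (CY v) = xpt r v" "\<And>v. \<theta> (CZ v) = secpt r v"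
    and zero: "poly_subst Const \<theta> Q = 0"
    and A: "ideal A (poly_ring (CX ` V \<union> CY ` V \<union> CZ ` V))"
    and Y: "\<And>q. q \<in> sv_ideal d \<Longrightarrow> rename CY q \<in> A"
    and Z: "\<And>q. q \<in> secant_kernel d r \<Longrightarrow> rename CZ q \<in> A"
  shows "Q \<in> A"
proof -
  let ?W = "CX ` V \<union> CY ` V \<union> CZ ` V"
  define \<alpha> \<beta> where "\<alpha> = (Poly_Mapping.map_key CY :: _ \<Rightarrow> (nat \<times> nat) monomial)"
    and "\<beta> = (Poly_Mapping.map_key CZ :: _ \<Rightarrow> (nat \<times> nat) monomial)"
  have inj: "inj (CY :: nat \<times> nat \<Rightarrow> _)" "inj (CZ :: nat \<times> nat \<Rightarrow> _)" by (auto simp: inj_on_def)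
  have \<mu>V: "keys \<mu> \<subseteq> CY ` V \<union> CZ ` V" if "\<mu> \<in> keys Q" for \<mu>
    using Q that by (simp add: polys_iff)
  have \<alpha>V: "keys (\<alpha> \<mu>) \<subseteq> V" and \<beta>V: "keys (\<beta> \<mu>) \<subseteq> V" if "\<mu> \<in> keys Q" for \<mu>
    using \<mu>V[OF that] by (auto simp: \<alpha>_def \<beta>_def keys_map_key inj)
  define y z where "y m = rename CY (single m (1 :: 'a))" and "z m = rename CZ (single m (1 :: 'a))"
    for m :: "(nat \<times> nat) monomial"
  have y: "y m = meval (\<lambda>v. Var (CY v)) m" and z: "z m = meval (\<lambda>v. Var (CZ v)) m" for m
    by (simp_all add: y_def z_def rename_subst)
  have yW: "y m \<in> polys ?W" and zW: "z m \<in> polys ?W" if "keys m \<subseteq> V" for m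
    using that unfolding y z meval_def by (auto intro!: polys_prod polys_power polys_Var)
  define c where "c \<mu> = (Const (lookup Q \<mu>) :: ((nat \<times> nat) copy, 'a) mpoly)" for \<mu>
  have single_split: "single \<mu> 1 = y (\<alpha> \<mu>) * z (\<beta> \<mu>)" if "\<mu> \<in> keys Q" for \<mu>
    using meval_split_copies[OF \<mu>V[OF that], of Var] by (simp add: y z \<alpha>_def \<beta>_def)
  have Q_eq: "Q = (\<Sum>\<mu>\<in>keys Q. c \<mu> * (y (\<alpha> \<mu>) * z (\<beta> \<mu>)))"
    by (subst sum_single_lookup[of Q])
      (auto intro!: sum.cong simp: c_def Const_mult_single simp flip: single_split)
  define n where "n \<mu> = nform d (\<alpha> \<mu>)" for \<mu>
  define Q' where "Q' = (\<Sum>\<mu>\<in>keys Q. c \<mu> * (y (n \<mu>) * z (\<beta> \<mu>)))"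
  have nV: "keys (n \<mu>) \<subseteq> V" and n_std: "standard (n \<mu>)" if "\<mu> \<in> keys Q" for \<mu>
    using \<alpha>V[OF that] nform_keys nform(2) unfolding n_def V_def by auto
  have "(\<Sum>\<mu>\<in>keys Q. (c \<mu> * z (\<beta> \<mu>)) * (y (\<alpha> \<mu>) - y (n \<mu>))) \<in> A"
  proof (intro ideal_sum[OF A] ideal_mult[OF A])
    fix \<mu> assume \<mu>: "\<mu> \<in> keys Q"
    have "y (\<alpha> \<mu>) - y (n \<mu>) = rename CY (single (\<alpha> \<mu>) 1 - single (n \<mu>) 1)"
      by (simp add: y_def rename_subst subst_Const.ps_minus)
    also have "\<dots> \<in> A"
      unfolding n_def using \<alpha>V[OF \<mu>] by (intro Y nform_in_sv_ideal) (simp add: V_def)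
    finally show "y (\<alpha> \<mu>) - y (n \<mu>) \<in> A" .
    show "c \<mu> * z (\<beta> \<mu>) \<in> polys ?W"
      unfolding c_def using \<beta>V[OF \<mu>] by (intro polys_mult polys_Const zW)
  qed
  also have "(\<Sum>\<mu>\<in>keys Q. (c \<mu> * z (\<beta> \<mu>)) * (y (\<alpha> \<mu>) - y (n \<mu>))) = Q - Q'"
    by (subst Q_eq) (simp add: Q'_def algebra_simps sum_subtractf)
  finally have diff: "Q - Q' \<in> A" .
  \<comment> \<open>Grouped by standard y-monomials \<open>s\<close>, \<open>Q'\<close> has
    coefficients \<open>q s\<close> in the z-indeterminates; independence will put each of them into
    the kernel for \<open>r\<close> points.\<close>
  define S where "S = n ` keys Q"
  define q where "q s = (\<Sum>\<mu>\<in>{\<mu>\<in>keys Q. n \<mu> = s}. single (\<beta> \<mu>) (lookup Q \<mu>))" for s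
  have rename_q: "rename CZ (q s) = (\<Sum>\<mu>\<in>{\<mu>\<in>keys Q. n \<mu> = s}. c \<mu> * z (\<beta> \<mu>))" for s
    by (simp add: q_def rename_subst subst_Const.ps_sum c_def z)
  have Q'_eq: "Q' = (\<Sum>s\<in>S. y s * rename CZ (q s))"
  proof -
    have "Q' = (\<Sum>s\<in>S. \<Sum>\<mu>\<in>{\<mu>\<in>keys Q. n \<mu> = s}. c \<mu> * (y (n \<mu>) * z (\<beta> \<mu>)))"
      unfolding Q'_def S_def by (rule sum.image_gen) simp
    also have "\<dots> = (\<Sum>s\<in>S. \<Sum>\<mu>\<in>{\<mu>\<in>keys Q. n \<mu> = s}. y s * (c \<mu> * z (\<beta> \<mu>)))"
      by (intro sum.cong) (auto simp: mult_ac)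
    finally show ?thesis by (simp only: rename_q sum_distrib_left)
  qed
  have qV: "q s \<in> polys V" for s
    unfolding q_def by (intro polys_sum polys_single) (use \<beta>V in auto)
  have \<theta>y: "poly_subst Const \<theta> (y m) = single (pwt r m) 1" for m
    by (simp add: y subst_Const.ps_meval \<theta> meval_xpt)
  have \<theta>z: "poly_subst Const \<theta> (rename CZ p) = poly_subst Const (secpt r) p" for p
    by (simp add: rename_subst subst_Const.ps_comp \<theta>)
  \<comment> \<open>Passing to normal forms preserves weights, hence images.\<close>
  have "poly_subst Const \<theta> Q' = poly_subst Const \<theta> Q"
  proof -
    have "pwt r (n \<mu>) = pwt r (\<alpha> \<mu>)" if "\<mu> \<in> keys Q" for \<mu>
      using nform_same_weight[of "\<alpha> \<mu>" d] \<alpha>V[OF that]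
      by (simp add: pwt_eq_iff n_def V_def same_weight_sym)
    then show ?thesis
      by (subst Q_eq) (auto simp: Q'_def subst_Const.ps_sum subst_Const.ps_mult \<theta>y intro!: sum.cong)
  qed
  with zero have sum0: "(\<Sum>s\<in>S. single (pwt r s) 1 * poly_subst Const (secpt r) (q s)) = 0"
    unfolding Q'_eq by (simp add: subst_Const.ps_sum subst_Const.ps_mult \<theta>y \<theta>z)
  have "q s \<in> secant_kernel d r" if "s \<in> S" for s
  proof -
    have "poly_subst Const (secpt r) (q s) = 0"
    proof (rule xpt_independent[OF _ _ _ sum0 that, of d])
      show "finite S" by (simp add: S_def)
      show "standard s \<and> keys s \<subseteq> sv_vars d" if "s \<in> S" for s
        using that nV n_std unfolding S_def V_def by auto
      show "poly_subst Const (secpt r) (q s) \<in> polys {..<3 * r}" for s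
        by (rule polys_subst[OF qV secpt_polys])
    qed
    with qV show ?thesis by (simp add: secant_kernel_def V_def)
  qed
  then have "Q' \<in> A"
    unfolding Q'_eq using nV by (intro ideal_sum[OF A] ideal_mult[OF A] Z yW) (auto simp: S_def)
  from ideal_add[OF A diff this] show ?thesis by simp
qed

text \<open>The new point uses the fresh triple \<open>r\<close>, so \<open>secpt (Suc r)\<close> is
  \<open>xpt r\<close> plus \<open>secpt r\<close>, matching x = y + z. One inclusion is this
  substitution; for the other, p(y + z) vanishes under it and \<open>two_copies_kernel\<close>
  applies.\<close>

lemma join_secant_kernel:
  "join_ideal (sv_vars d) (sv_ideal d) (secant_kernel d r)
    = (secant_kernel d (Suc r) :: (nat \<times> nat, 'a::comm_ring_1) mpoly set)"
proof
  let ?V = "sv_vars d"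
  show "join_ideal ?V (sv_ideal d) (secant_kernel d r)
      \<subseteq> (secant_kernel d (Suc r) :: (nat \<times> nat, 'a) mpoly set)"
  proof
    fix p :: "(nat \<times> nat, 'a) mpoly"
    assume p: "p \<in> join_ideal ?V (sv_ideal d) (secant_kernel d r)"
    define \<sigma> :: "(nat \<times> nat) copy \<Rightarrow> (nat, 'a) mpoly"
      where "\<sigma> x = (case x of CX v \<Rightarrow> secpt (Suc r) v | CY v \<Rightarrow> xpt r v | CZ v \<Rightarrow> secpt r v)" for x
    have "poly_subst Const (\<lambda>v. \<sigma> (CX v)) p = 0"
    proof (rule join_vanish[OF p])
      fix q :: "(nat \<times> nat, 'a) mpoly"
      show "poly_subst Const (\<lambda>v. \<sigma> (CY v)) q = 0" if "q \<in> sv_ideal d"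
        using that subst_xpt_eq_0_iff[of r q]
        unfolding sv_ideal_eq_secant_kernel secant_kernel_1_iff by (simp add: \<sigma>_def)
      show "poly_subst Const (\<lambda>v. \<sigma> (CZ v)) q = 0" if "q \<in> secant_kernel d r"
        using that by (simp add: secant_kernel_def \<sigma>_def)
    qed (simp_all add: \<sigma>_def secpt_def sv_ideal_polys secant_kernel_polys)
    moreover have "p \<in> polys ?V" using p by (simp add: join_ideal_def)
    ultimately show "p \<in> secant_kernel d (Suc r)" by (simp add: secant_kernel_def \<sigma>_def)
  qed
  show "(secant_kernel d (Suc r) :: (nat \<times> nat, 'a) mpoly set)
      \<subseteq> join_ideal ?V (sv_ideal d) (secant_kernel d r)"
  proof
    fix p :: "(nat \<times> nat, 'a) mpoly"
    assume "p \<in> secant_kernel d (Suc r)"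
    then have pV: "p \<in> polys ?V" and p0: "poly_subst Const (secpt (Suc r)) p = 0"
      by (simp_all add: secant_kernel_def)
    note G = join_generators_polys[OF sv_ideal_polys secant_kernel_polys]
    define \<theta> :: "(nat \<times> nat) copy \<Rightarrow> (nat, 'a) mpoly"
      where "\<theta> x = (case x of CX v \<Rightarrow> 0 | CY v \<Rightarrow> xpt r v | CZ v \<Rightarrow> secpt r v)" for x
    show "p \<in> join_ideal ?V (sv_ideal d) (secant_kernel d r)"
    proof (rule join_memberI[OF pV sv_ideal_polys secant_kernel_polys refl]
        , rule two_copies_kernel[where \<theta> = \<theta> and r = r])
      show "poly_subst Const (\<lambda>v. Var (CY v) + Var (CZ v)) p \<in> polys (CY ` ?V \<union> CZ ` ?V)"
        using pV by (rule polys_subst) (auto intro!: polys_add polys_Var)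
      have "(\<lambda>v. poly_subst Const \<theta> (Var (CY v) + Var (CZ v))) = secpt (Suc r)"
        by (auto simp: fun_eq_iff subst_Const.ps_add \<theta>_def secpt_def add.commute)
      then show "poly_subst Const \<theta> (poly_subst Const (\<lambda>v. Var (CY v) + Var (CZ v)) p) = 0"
        using p0 by (simp add: subst_Const.ps_comp)
    qed ((rule Idl_ideal[OF G] | (rule Idl_self[OF G], blast) | simp add: \<theta>_def)+)
  qed
qed

lemma secant_ideal_Suc:
  assumes "1 \<le> r"
  shows "secant_ideal V (Suc r) I = join_ideal V I (secant_ideal V r I)"
proof -
  obtain k where "r = Suc k" using assms by (cases r) auto
  then show ?thesis by (simp add: secant_ideal_def)
qed

lemma secant_ideal_sv_ideal:
  assumes "1 \<le> r"
  shows "secant_ideal (sv_vars d) r (sv_ideal d)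
    = (secant_kernel d r :: (nat \<times> nat, 'a::comm_ring_1) mpoly set)"
  using assms
proof (induction r rule: nat_induct_at_least)
  case base
  show ?case by (simp add: secant_ideal_def sv_ideal_eq_secant_kernel)
next
  case (Suc r)
  then show ?case by (simp add: secant_ideal_Suc join_secant_kernel)
qed

section \<open>Leading monomials\<close>

lemma term_order_facts:
  assumes "term_order V ord"
  shows "m \<in> monomials V \<Longrightarrow> (m, m) \<in> ord"
    and "(a, b) \<in> ord \<Longrightarrow> (b, c) \<in> ord \<Longrightarrow> (a, c) \<in> ord"
    and "(a, b) \<in> ord \<Longrightarrow> (b, a) \<in> ord \<Longrightarrow> a = b"
    and "m \<in> monomials V \<Longrightarrow> n \<in> monomials V \<Longrightarrow> (m, n) \<in> ord \<or> (n, m) \<in> ord"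
    and "(a, b) \<in> ord \<Longrightarrow> k \<in> monomials V \<Longrightarrow> (a + k, b + k) \<in> ord"
proof -
  from assms have *: "linear_order_on (monomials V) ord"
    "(a, b) \<in> ord \<Longrightarrow> k \<in> monomials V \<Longrightarrow> (a + k, b + k) \<in> ord"
    unfolding term_order_def by blast+
  from *(1) have "refl_on (monomials V) ord" "trans ord" "antisym ord" "total_on (monomials V) ord"
    by (simp_all add: linear_order_on_def partial_order_on_def preorder_on_def)
  note o = this
  show "m \<in> monomials V \<Longrightarrow> (m, m) \<in> ord"
    using o(1) by (simp add: refl_on_def)
  show "(a, b) \<in> ord \<Longrightarrow> (b, c) \<in> ord \<Longrightarrow> (a, c) \<in> ord"
    by (rule transD[OF o(2)])
  show "(a, b) \<in> ord \<Longrightarrow> (b, a) \<in> ord \<Longrightarrow> a = b"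
    by (rule antisymD[OF o(3)])
  show "m \<in> monomials V \<Longrightarrow> n \<in> monomials V \<Longrightarrow> (m, n) \<in> ord \<or> (n, m) \<in> ord"
    using o(1,4) by (cases "m = n") (auto simp: refl_on_def total_on_def)
  show "(a, b) \<in> ord \<Longrightarrow> k \<in> monomials V \<Longrightarrow> (a + k, b + k) \<in> ord" by (rule *(2))
qed

lemma monomials_iff: "m \<in> monomials V \<longleftrightarrow> keys m \<subseteq> V"
  by (simp add: monomials_def)

lemma keys_sum_subset: "keys (sum f A) \<subseteq> (\<Union>a\<in>A. keys (f a))"
  for f :: "'b \<Rightarrow> 'c \<Rightarrow>\<^sub>0 'd::comm_monoid_add"
  using Poly_Mapping.keys_add by (induction A rule: infinite_finite_induct) fastforce+

lemma monomials_sum: "(\<And>a. a \<in> A \<Longrightarrow> f a \<in> monomials V) \<Longrightarrow> sum f A \<in> monomials V"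
  using keys_sum_subset[of f A] unfolding monomials_iff by blast

lemma initial_monomial:
  assumes ord: "term_order V ord" and p: "p \<in> polys V" "p \<noteq> 0"
  obtains m where "m \<in> keys p" "\<And>n. n \<in> keys p \<Longrightarrow> (n, m) \<in> ord" "initial_monomial ord p = single m 1"
proof -
  note o = term_order_facts[OF ord]
  have "\<exists>m\<in>S. \<forall>n\<in>S. (n, m) \<in> ord" if "finite S" "S \<noteq> {}" "S \<subseteq> monomials V" for S
    using that
  proof (induction S rule: finite_ne_induct)
    case (singleton x)
    then show ?case using o(1) by auto
  next
    case (insert x S)
    then obtain m where m: "m \<in> S" "\<And>n. n \<in> S \<Longrightarrow> (n, m) \<in> ord" by auto
    have mx: "m \<in> monomials V" "x \<in> monomials V" using m(1) insert.prems by auto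
    show ?case
    proof (cases "(x, m) \<in> ord")
      case True
      with m show ?thesis by auto
    next
      case False
      with o(4)[OF mx] have "(m, x) \<in> ord" by blast
      with o(1)[OF mx(2)] o(2)[OF m(2)] show ?thesis by auto
    qed
  qed
  moreover have "keys p \<subseteq> monomials V" "keys p \<noteq> {}"
    using p by (auto simp: polys_iff monomials_iff)
  ultimately obtain m where m: "m \<in> keys p" "\<forall>n\<in>keys p. (n, m) \<in> ord"
    using finite_keys[of p] by blast
  have "(THE m. m \<in> keys p \<and> (\<forall>n\<in>keys p. (n, m) \<in> ord)) = m"
    using m o(3) by (intro the_equality) blast+
  with m show thesis by (intro that[of m]) (auto simp: initial_monomial_def)
qed

text \<open>A 2 x 2 minor is the difference of two monomials and the order selects its diagonal, so
  the antidiagonal is smaller; multiplication by \<delta> preserves this.\<close>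

lemma hstep_ord:
  fixes ord :: "(nat \<times> nat) monomial rel"
  assumes diag: "diagonal_term_order TYPE('a::comm_ring_1) d ord" and h: "hstep d m m'"
  shows "(m', m) \<in> ord"
proof -
  have ord: "term_order (sv_vars d) ord"
    using diag by (simp add: diagonal_term_order_def)
  from h obtain \<delta> v w where *: "keys \<delta> \<subseteq> sv_vars d" "v \<in> sv_vars d" "w \<in> sv_vars d" "below v w"
    "m = \<delta> + (single v 1 + single w 1)"
    "m' = \<delta> + (single (entry_index (hrow v) (hcol w)) 1 + single (entry_index (hrow w) (hcol v)) 1)"
    unfolding hstep_def by blast
  let ?a = "single v 1 + single w 1 :: (nat \<times> nat) monomial"
    and ?b = "single (entry_index (hrow v) (hcol w)) 1 + single (entry_index (hrow w) (hcol v)) 1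
      :: (nat \<times> nat) monomial"
  have step: "hstep d ?a ?b"
    unfolding hstep_def using *(2-4) by (intro exI[of _ 0] exI[of _ v] exI[of _ w]) simp
  \<comment> \<open>Otherwise the minor would be zero and its initial monomial meaningless.\<close>
  then have "?a \<noteq> ?b" using hstep_decreases by (metis less_irrefl)
  have C: "{v, w} \<subseteq> sv_vars d" "chain {v, w}" using *(2-4) pair_chain by auto
  let ?D = "det (submatrix (block_hankel d (d div 2)) (hrow ` {v, w}) (hcol ` {v, w}))
    :: (nat \<times> nat, 'a) mpoly"
  have D: "?D = single ?a 1 - single ?b 1" by (rule chain_minor_pair[OF *(2-4)])
  have keys_D: "keys ?D = {?a, ?b}"
    unfolding D using \<open>?a \<noteq> ?b\<close> by (auto simp: in_keys_iff lookup_minus lookup_single when_def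
        split: if_splits)
  have "v \<noteq> w" using *(4) by auto
  then have sum_C: "(\<Sum>c\<in>{v, w}. single c 1) = ?a" by simp
  have "initial_monomial ord ?D
      = prod_list (diag_mat (submatrix (block_hankel d (d div 2)) (hrow ` {v, w}) (hcol ` {v, w})))"
    using diag chain_minor(1-4)[OF C] unfolding diagonal_term_order_def Let_def
    by (simp del: image_insert)
  also have "\<dots> = single ?a 1"
    unfolding diagonal_chain_minor[OF C] sum_C ..
  finally have init: "initial_monomial ord ?D = single ?a 1" .
  have DV: "?D \<in> polys (sv_vars d)"
    unfolding polys_iff keys_D using hstep_keys[OF step] by blast
  have "?D \<noteq> 0" using keys_D by auto
  from initial_monomial[OF ord DV this] obtain l where
    l: "\<And>n. n \<in> keys ?D \<Longrightarrow> (n, l) \<in> ord" "initial_monomial ord ?D = single l 1" by metis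
  have "single l (1::'a) = single ?a 1" using l(2) init by simp
  then have "l = ?a" by (metis keys_single one_neq_zero singleton_inject)
  moreover have "(?b, l) \<in> ord" by (rule l(1)) (simp only: keys_D insert_iff simp_thms)
  ultimately have "(?b, ?a) \<in> ord" by simp
  from term_order_facts(5)[OF ord this, of \<delta>] *(1) show ?thesis
    unfolding *(5,6) by (simp add: monomials_iff add.commute)
qed

lemma hsteps_ord:
  assumes diag: "diagonal_term_order TYPE('a::comm_ring_1) d ord"
    and "(hstep d)\<^sup>*\<^sup>* m m'" "keys m \<subseteq> sv_vars d"
  shows "(m', m) \<in> ord"
  using assms(2)
proof (induction rule: rtranclp_induct)
  case base
  from diag assms(3) show ?case
    by (auto simp: diagonal_term_order_def monomials_iff intro: term_order_facts(1))
next
  case (step a b)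
  from diag have "term_order (sv_vars d) ord" by (simp add: diagonal_term_order_def)
  from term_order_facts(2)[OF this hstep_ord[OF diag step.hyps(2)] step.IH] show ?case .
qed

section \<open>Expansion of the image of a monomial by colours\<close>

lemma monomial_induct [case_names zero add]:
  fixes m :: "'v monomial"
  assumes "P 0" and "\<And>m v. P m \<Longrightarrow> P (m + single v 1)"
  shows "P m"
proof (induction "wsum (\<lambda>_. 1) m" arbitrary: m)
  case 0
  then have "m = 0" by (auto simp: wsum_def in_keys_iff intro: poly_mapping_eqI)
  with assms(1) show ?case by simp
next
  case (Suc n)
  then obtain v where v: "v \<in> keys m" by (metis ex_in_conv wsum_def sum.empty Zero_not_Suc)
  have m: "m = (m - single v 1) + single v 1"
    using v by (auto intro!: poly_mapping_eqI simp: lookup_add lookup_minus lookup_single when_def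
        in_keys_iff)
  have "P (m - single v 1)"
  proof (rule Suc.hyps(1))
    have "wsum (\<lambda>_. 1) m = wsum (\<lambda>_. 1) (m - single v 1) + 1"
      by (subst m) (simp add: wsum_add)
    with Suc.hyps(2) show "n = wsum (\<lambda>_. 1) (m - single v 1)" by simp
  qed
  then show ?case by (subst m) (rule assms(2))
qed

definition colour_part :: "('v \<Rightarrow> nat) \<Rightarrow> 'v monomial \<Rightarrow> nat \<Rightarrow> 'v monomial" where
  "colour_part f m l = Poly_Mapping.mapp (\<lambda>v c. if f v = l then c else 0) m"

lemma lookup_colour_part: "lookup (colour_part f m l) v = (if f v = l then lookup m v else 0)"
  by (simp add: colour_part_def lookup_mapp when_def in_keys_iff)

lemma keys_colour_part: "keys (colour_part f m l) = {v \<in> keys m. f v = l}"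
  by (auto simp: in_keys_iff lookup_colour_part split: if_splits)

lemma sum_colour_part:
  assumes "\<And>v. v \<in> keys m \<Longrightarrow> f v < r"
  shows "(\<Sum>l<r. colour_part f m l) = m"
proof (rule poly_mapping_eqI)
  fix v
  show "lookup (\<Sum>l<r. colour_part f m l) v = lookup m v"
    using assms[of v] by (auto simp: lookup_sum lookup_colour_part in_keys_iff)
qed

lemma colour_part_add_single:
  "colour_part f (m + single v 1) = (colour_part f m)(f v := colour_part f m (f v) + single v 1)"
  by (auto simp: fun_eq_iff lookup_colour_part lookup_add lookup_single when_def
      intro!: poly_mapping_eqI)

text \<open>The exponent of the term to which the factors in \<open>g l\<close> contribute their
  \<open>l\<close>-th summands.\<close>

definition pwts :: "nat \<Rightarrow> (nat \<Rightarrow> (nat \<times> nat) monomial) \<Rightarrow> nat monomial" where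
  "pwts r g = (\<Sum>l<r. pwt l (g l))"

lemma sum_fun_upd_add:
  fixes h :: "nat \<Rightarrow> 'b::comm_monoid_add \<Rightarrow> 'c::comm_monoid_add"
  assumes "\<And>a b. h k (a + b) = h k a + h k b" "k < r"
  shows "(\<Sum>l<r. h l ((g(k := g k + x)) l)) = (\<Sum>l<r. h l (g l)) + h k x"
proof -
  have "(\<Sum>l<r. h l ((g(k := g k + x)) l)) = h k (g k + x) + (\<Sum>l\<in>{..<r} - {k}. h l (g l))"
    using assms(2) by (subst sum.remove[of _ k]) (auto intro!: sum.cong)
  also have "\<dots> = (\<Sum>l<r. h l (g l)) + h k x"
    using assms by (subst (2) sum.remove[of _ k]) (auto simp: ac_simps)
  finally show ?thesis .
qed

lemma pwts_upd:
  assumes "k < r"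
  shows "pwts r (g(k := g k + x)) = pwts r g + pwt k x"
  unfolding pwts_def by (rule sum_fun_upd_add) (simp_all add: pwt_add assms)

lemma sum_upd:
  fixes g :: "nat \<Rightarrow> 'v monomial"
  assumes "k < r"
  shows "(\<Sum>l<r. (g(k := g k + x)) l) = (\<Sum>l<r. g l) + x"
  using sum_fun_upd_add[of "\<lambda>_ a. a" k r g x] assms by simp

lemma secpt_eq: "secpt r v = (\<Sum>l<r. single (pwt l (single v 1)) 1)"
  by (simp add: secpt_def xpt_eq)

text \<open>Each term of the expansion distributes the factors of \<open>m\<close> over the
  \<open>r\<close> summands. The converse can fail, as multinomial coefficients may vanish in the
  coefficient ring.\<close>

lemma keys_meval_secpt:
  "\<kappa> \<in> keys (meval (secpt r) m :: (nat, 'a::comm_ring_1) mpoly)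
    \<Longrightarrow> \<exists>g. (\<Sum>l<r. g l) = m \<and> \<kappa> = pwts r g"
proof (induction m arbitrary: \<kappa> rule: monomial_induct)
  case zero
  then show ?case by (intro exI[of _ "\<lambda>_. 0"]) (auto simp: pwts_def split: if_splits)
next
  case (add m v)
  from add.prems have "\<kappa> \<in> keys (meval (secpt r) m * secpt r v :: (nat, 'a) mpoly)"
    by (simp add: meval_add)
  then obtain \<kappa>1 \<kappa>2 where \<kappa>: "\<kappa> = \<kappa>1 + \<kappa>2" "\<kappa>1 \<in> keys (meval (secpt r) m :: (nat, 'a) mpoly)"
    "\<kappa>2 \<in> keys (secpt r v :: (nat, 'a) mpoly)"
    using keys_mult by blast
  from add.IH[OF \<kappa>(2)] obtain g where g: "(\<Sum>l<r. g l) = m" "\<kappa>1 = pwts r g" by blast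
  from \<kappa>(3) keys_sum_subset[of "\<lambda>l. single (pwt l (single v 1)) (1::'a)" "{..<r}"] obtain k
    where k: "k < r" "\<kappa>2 = pwt k (single v 1)"
    unfolding secpt_eq by (auto split: if_splits)
  show ?case
    using sum_upd[OF k(1), of g "single v 1"] pwts_upd[OF k(1), of g "single v 1"] g k \<kappa>(1) by metis
qed

text \<open>Expanding the product, exactly one term is the one in which every indeterminate \<open>v\<close>
  contributes its \<open>f v\<close>-th summand.\<close>

lemma keys_meval_secpt_colour:
  assumes "\<And>v. v \<in> keys m \<Longrightarrow> f v < r"
    and "\<kappa> \<in> keys (meval (secpt r) m - single (pwts r (colour_part f m)) 1 :: (nat, 'a::comm_ring_1) mpoly)"
  shows "\<exists>g. (\<Sum>l<r. g l) = m \<and> \<kappa> = pwts r g \<and> (\<exists>l<r. g l \<noteq> colour_part f m l)"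
  using assms
proof (induction m arbitrary: \<kappa> rule: monomial_induct)
  case zero
  have "colour_part f (0 :: (nat \<times> nat) monomial) l = 0" for l
    by (rule poly_mapping_eqI) (simp add: lookup_colour_part)
  with zero show ?case by (simp add: pwts_def)
next
  case (add m v)
  have col: "f u < r" if "u \<in> keys m" for u
    using that by (intro add.prems(1)) (auto simp: in_keys_iff lookup_add)
  have fv: "f v < r" by (intro add.prems(1)) (auto simp: in_keys_iff lookup_add)
  let ?c = "colour_part f m" and ?c' = "colour_part f (m + single v 1)"
  let ?M = "meval (secpt r) m :: (nat, 'a) mpoly"
    and ?X = "\<lambda>l. single (pwt l (single v 1)) (1::'a)"
  \<comment> \<open>The new factor \<open>v\<close> contributes either its \<open>f v\<close>-th
    summand, where the induction hypothesis applies, or another one, which already violates the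
    colouring.\<close>
  let ?rest = "\<Sum>l\<in>{..<r} - {f v}. ?X l"
  have "secpt r v = ?X (f v) + ?rest"
    unfolding secpt_eq using fv by (subst sum.remove[of _ "f v"]) auto
  moreover have "single (pwts r ?c') (1::'a) = single (pwts r ?c) 1 * ?X (f v)"
    unfolding colour_part_add_single pwts_upd[OF fv] by (simp add: mult_single)
  ultimately have "meval (secpt r) (m + single v 1) - single (pwts r ?c') 1
      = (?M - single (pwts r ?c) 1) * ?X (f v) + ?M * ?rest"
    by (simp add: meval_add algebra_simps)
  with add.prems(2) have "\<kappa> \<in> keys ((?M - single (pwts r ?c) 1) * ?X (f v) + ?M * ?rest)"
    by (simp only:)
  then consider
    "\<kappa> \<in> keys ((?M - single (pwts r ?c) 1) * ?X (f v))" | "\<kappa> \<in> keys (?M * ?rest)"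
    using Poly_Mapping.keys_add[of "(?M - single (pwts r ?c) 1) * ?X (f v)" "?M * ?rest"] by blast
  then show ?case
  proof cases
    case 1
    then obtain \<kappa>1 where \<kappa>: "\<kappa>1 \<in> keys (?M - single (pwts r ?c) 1)" "\<kappa> = \<kappa>1 + pwt (f v) (single v 1)"
      using keys_mult[of "?M - single (pwts r ?c) 1" "?X (f v)"] by (auto simp del: One_nat_def)
    from add.IH[OF col \<kappa>(1)] obtain g l where
      g: "(\<Sum>l<r. g l) = m" "\<kappa>1 = pwts r g" "l < r" "g l \<noteq> ?c l" by blast
    have "(g(f v := g (f v) + single v 1)) l \<noteq> ?c' l"
      unfolding colour_part_add_single using g(4) by auto
    with g(3) show ?thesis
      using sum_upd[OF fv, of g "single v 1"] pwts_upd[OF fv, of g "single v 1"] g(1,2) \<kappa>(2) by metis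
  next
    case 2
    then obtain \<kappa>1 \<kappa>2 where \<kappa>: "\<kappa>1 \<in> keys ?M" "\<kappa>2 \<in> keys ?rest" "\<kappa> = \<kappa>1 + \<kappa>2"
      using keys_mult by blast
    from \<kappa>(2) keys_sum_subset[of ?X "{..<r} - {f v}"] obtain k
      where k: "k < r" "k \<noteq> f v" "\<kappa>2 = pwt k (single v 1)" by (auto split: if_splits)
    from keys_meval_secpt[OF \<kappa>(1)] obtain g where g: "(\<Sum>l<r. g l) = m" "\<kappa>1 = pwts r g" by blast
    have "lookup ((g(k := g k + single v 1)) k) v \<noteq> lookup (?c' k) v"
      using k(2) by (simp add: lookup_colour_part lookup_add)
    then have "(g(k := g k + single v 1)) k \<noteq> ?c' k" by metis
    with k(1) show ?thesis
      using sum_upd[OF k(1), of g "single v 1"] pwts_upd[OF k(1), of g "single v 1"] g \<kappa>(3) k(3) by metis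
  qed
qed

lemma pwts_eq_imp_same_weight:
  assumes "pwts r g = pwts r g'" "l < r"
  shows "same_weight (g l) (g' l)"
proof -
  have "lookup (pwts r g) x = (\<Sum>k<r. lookup (pwt k (g k)) x)" for g x
    by (simp add: pwts_def lookup_sum)
  then have *: "(\<Sum>k<r. lookup (pwt k (g k)) x) = (\<Sum>k<r. lookup (pwt k (g' k)) x)" for x
    using assms(1) by metis
  have delta: "(\<Sum>k<r. if l = k then h k else 0) = h l" for h :: "nat \<Rightarrow> nat"
    using assms(2) by simp
  from *[of "3 * l"] *[of "3 * l + 1"] *[of "3 * l + 2"] show ?thesis
    unfolding lookup_pwt delta same_weight_def by simp
qed

text \<open>Suppose that the leading monomial \<open>m\<close> is a product of \<open>r\<close> standard monomials \<open>c l\<close> with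
  disjoint supports.  Every other monomial contributing to the coefficient of the product of their
  weights is a product of monomials of the same weights, which are larger than the \<open>c l\<close>.
  Hence this coefficient is that of \<open>m\<close> in \<open>p\<close>.\<close>

lemma leading_monomial_chain:
  fixes p :: "(nat \<times> nat, 'a::comm_ring_1) mpoly"
  assumes diag: "diagonal_term_order TYPE('a) d ord"
    and p: "p \<in> secant_kernel d r" and m: "m \<in> keys p" "\<And>n. n \<in> keys p \<Longrightarrow> (n, m) \<in> ord"
  shows "\<exists>C\<subseteq>keys m. chain C \<and> card C = Suc r"
proof (rule ccontr)
  assume "\<not> ?thesis"
  then have "\<exists>f. (\<forall>v\<in>keys m. f v < r) \<and> (\<forall>v\<in>keys m. \<forall>w\<in>keys m. f v = f w \<longrightarrow> \<not> below v w)"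
    by (intro chain_colouring) auto
  then obtain f where f: "\<And>v. v \<in> keys m \<Longrightarrow> f v < r"
    "\<And>v w. v \<in> keys m \<Longrightarrow> w \<in> keys m \<Longrightarrow> f v = f w \<Longrightarrow> \<not> below v w" by blast
  have ord: "term_order (sv_vars d) ord"
    using diag by (simp add: diagonal_term_order_def)
  note o = term_order_facts[OF ord]
  have V: "keys n \<subseteq> sv_vars d" if "n \<in> keys p" for n
    using p that by (auto simp: secant_kernel_def polys_iff)
  define c where "c = colour_part f m"
  have cV: "keys (c l) \<subseteq> sv_vars d" for l
    using V[OF m(1)] by (auto simp: c_def keys_colour_part)
  have c_std: "standard (c l)" for l
    unfolding standard_def c_def keys_colour_part using f(2) by auto
  have c_sum: "(\<Sum>l<r. c l) = m"
    unfolding c_def by (rule sum_colour_part) (rule f(1))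
  have unique: "g l = c l"
    if g: "(\<Sum>l<r. g l) \<in> keys p" "pwts r g = pwts r c" and l: "l < r" for g l
  proof -
    let ?n = "\<Sum>l<r. g l"
    have gV: "keys (g k) \<subseteq> sv_vars d" if "k < r" for k
    proof -
      have "lookup (g k) v \<le> lookup ?n v" for v
        unfolding lookup_sum using that by (intro member_le_sum) auto
      then have "keys (g k) \<subseteq> keys ?n" by (metis in_keys_iff le_zero_eq subsetI)
      with V[OF g(1)] show ?thesis by blast
    qed
    \<comment> \<open>\<open>c k\<close> is the standard monomial of the weight of
      \<open>g k\<close>, hence its normal form, and reduction only goes down.\<close>
    have le: "(c k, g k) \<in> ord" if "k < r" for k
    proof -
      have "same_weight (g k) (c k)" using pwts_eq_imp_same_weight[OF g(2) that] .
      then have "nform d (g k) = c k"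
        using nform_same_weight[OF gV[OF that]] nform(2)[OF gV[OF that]] nform_keys[OF gV[OF that]]
          c_std cV by (intro standard_unique) (auto simp: same_weight_def)
      with hsteps_ord[OF diag nform(1)[OF gV[OF that]] gV[OF that]] show ?thesis by simp
    qed
    have mono: "(\<Sum>k\<in>A. c k, \<Sum>k\<in>A. g k) \<in> ord" if "A \<subseteq> {..<r}" for A
      using finite_subset[OF that finite_lessThan] that
    proof (induction A rule: finite_induct)
      case empty
      show ?case by (simp add: o(1) monomials_iff)
    next
      case (insert k A)
      have "(\<Sum>k\<in>A. c k) \<in> monomials (sv_vars d)"
        by (rule monomials_sum) (simp add: monomials_iff cV)
      then have "(c k + (\<Sum>k\<in>A. c k), g k + (\<Sum>k\<in>A. c k)) \<in> ord"
        using insert.prems by (intro o(5) le) auto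
      moreover have "((\<Sum>k\<in>A. c k) + g k, (\<Sum>k\<in>A. g k) + g k) \<in> ord"
        using insert gV by (intro o(5)) (auto simp: monomials_iff)
      ultimately show ?case
        using insert.hyps o(2) by (simp add: add.commute)
    qed
    \<comment> \<open>Maximality of \<open>m\<close> turns the inequality of the products into an
      equality.\<close>
    have "(m, ?n) \<in> ord" using mono[of "{..<r}"] c_sum by simp
    with m(2)[OF g(1)] have "?n = m" by (rule o(3))
    let ?A = "{..<r} - {l}"
    have split: "(\<Sum>k<r. h k) = h l + (\<Sum>k\<in>?A. h k)" for h :: "nat \<Rightarrow> (nat \<times> nat) monomial"
      using l by (subst sum.remove[of _ l]) auto
    have "(\<Sum>k\<in>?A. c k) \<in> monomials (sv_vars d)"
      by (rule monomials_sum) (simp add: monomials_iff cV)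
    then have 1: "(c l + (\<Sum>k\<in>?A. c k), g l + (\<Sum>k\<in>?A. c k)) \<in> ord"
      by (intro o(5) le l)
    have 2: "((\<Sum>k\<in>?A. c k) + g l, (\<Sum>k\<in>?A. g k) + g l) \<in> ord"
      using gV[OF l] by (intro o(5) mono) (auto simp: monomials_iff)
    have "c l + (\<Sum>k\<in>?A. c k) = g l + (\<Sum>k\<in>?A. g k)"
      using \<open>?n = m\<close> c_sum split[of c] split[of g] by simp
    \<comment> \<open>Replacing first the factor \<open>c l\<close> and then the others by those of
      \<open>g\<close> gives two increases whose total is zero, so the first one is an
      equality.\<close>
    with 1 2 have "g l + (\<Sum>k\<in>?A. c k) = c l + (\<Sum>k\<in>?A. c k)"
      by (intro o(3)) (simp_all add: add.commute)
    then show ?thesis by simp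
  qed
  let ?K = "pwts r c"
  have other: "lookup (meval (secpt r) n) ?K = (0::'a)" if "n \<in> keys p" "n \<noteq> m" for n
  proof (rule ccontr)
    assume "lookup (meval (secpt r) n) ?K \<noteq> (0::'a)"
    then have "?K \<in> keys (meval (secpt r) n :: (nat, 'a) mpoly)" by (simp add: in_keys_iff)
    from keys_meval_secpt[OF this] obtain g where g: "(\<Sum>l<r. g l) = n" "?K = pwts r g" by blast
    then have "g l = c l" if "l < r" for l using unique[of g l] that \<open>n \<in> keys p\<close> by simp
    then have "(\<Sum>l<r. g l) = (\<Sum>l<r. c l)" by (intro sum.cong) simp_all
    then have "n = m" using g(1) c_sum by simp
    with that(2) show False by simp
  qed
  \<comment> \<open>Exactly one term of the expansion has this exponent, so the coefficient is 1 in
    every characteristic.\<close>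
  have self: "lookup (meval (secpt r) m) ?K = (1::'a)"
  proof -
    have "?K \<notin> keys (meval (secpt r) m - single ?K 1 :: (nat, 'a) mpoly)"
    proof
      assume "?K \<in> keys (meval (secpt r) m - single ?K 1 :: (nat, 'a) mpoly)"
      then have "\<exists>g. (\<Sum>l<r. g l) = m \<and> ?K = pwts r g \<and> (\<exists>l<r. g l \<noteq> c l)"
        unfolding c_def using f(1) by (intro keys_meval_secpt_colour)
      then obtain g l where
        "(\<Sum>l<r. g l) = m" "?K = pwts r g" "l < r" "g l \<noteq> c l" by blast
      with unique[of g l] m(1) show False by simp
    qed
    then show ?thesis by (simp add: in_keys_iff lookup_minus)
  qed
  have "0 = lookup (poly_subst Const (secpt r) p) ?K"
    using p by (simp add: secant_kernel_def)
  also have "\<dots> = (\<Sum>n\<in>keys p. lookup (Const (lookup p n) * meval (secpt r) n) ?K)"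
    by (simp add: poly_subst_def meval_def lookup_sum)
  also have "\<dots> = (\<Sum>n\<in>keys p. if n = m then lookup p m else 0)"
  proof (intro sum.cong refl)
    fix n assume "n \<in> keys p"
    have "lookup (Const b * q) k = b * lookup q k" for b and q :: "(nat, 'a) mpoly" and k
      unfolding Const_def by (subst mult_map_scale_conv_mult[symmetric]) (simp add: map.rep_eq when_def)
    with \<open>n \<in> keys p\<close> other self
    show "lookup (Const (lookup p n) * meval (secpt r) n) ?K = (if n = m then lookup p m else 0)"
      by simp
  qed
  also have "\<dots> = lookup p m" using m(1) by simp
  finally show False using m(1) by (simp add: in_keys_iff)
qed

section \<open>Initial ideals of the secant ideals\<close>

text \<open>A squarefree monomial ideal described through supports, so that membership is checked
  term by term. For n = r + 1 its Stanley-Reisner faces are the unions of \<open>r\<close>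
  antichains.\<close>

definition chain_ideal :: "nat \<Rightarrow> nat \<Rightarrow> (nat \<times> nat, 'a::comm_ring_1) mpoly set" where
  "chain_ideal d n = {p \<in> polys (sv_vars d). \<forall>m\<in>keys p. \<exists>C\<subseteq>keys m. chain C \<and> card C = n}"

lemma chain_ideal_ideal:
  "ideal (chain_ideal d n :: (nat \<times> nat, 'a::comm_ring_1) mpoly set) (poly_ring (sv_vars d))"
proof (rule poly_idealI)
  fix p q :: "(nat \<times> nat, 'a) mpoly"
  assume p: "p \<in> chain_ideal d n"
  show "p + q \<in> chain_ideal d n" if "q \<in> chain_ideal d n"
    using p that Poly_Mapping.keys_add[of p q] polys_add[of p _ q]
    unfolding chain_ideal_def by blast
  show "q * p \<in> chain_ideal d n" if q: "q \<in> polys (sv_vars d)"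
  proof -
    have "\<exists>C\<subseteq>keys m. chain C \<and> card C = n" if mem: "m \<in> keys (q * p)" for m
    proof -
      obtain a b where m: "b \<in> keys p" "m = a + b" using subsetD[OF keys_mult mem] by blast
      have "keys b \<subseteq> keys m" by (auto simp: m(2) in_keys_iff lookup_add)
      moreover obtain C where "C \<subseteq> keys b" "chain C" "card C = n"
        using p m(1) unfolding chain_ideal_def by blast
      ultimately show ?thesis by blast
    qed
    moreover have "q * p \<in> polys (sv_vars d)"
      using p q by (intro polys_mult) (auto simp: chain_ideal_def)
    ultimately show ?thesis by (simp add: chain_ideal_def)
  qed
qed (auto simp: chain_ideal_def)

lemma chain_ideal_polys: "chain_ideal d n \<subseteq> polys (sv_vars d)"
  by (auto simp: chain_ideal_def)

lemma finite_sv_vars: "finite (sv_vars d)"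
  by (simp add: sv_vars_def)

lemma monomial_divide:
  fixes m :: "'v monomial"
  assumes "C \<subseteq> keys m"
  obtains \<delta> where "m = \<delta> + (\<Sum>c\<in>C. single c 1)" "keys \<delta> \<subseteq> keys m"
proof
  have fin: "finite C" using assms finite_keys by (rule finite_subset)
  have lk: "lookup (\<Sum>c\<in>C. single c 1) v = (if v \<in> C then 1 else 0 :: nat)" for v
    using fin by (simp add: lookup_sum lookup_single when_def)
  show "m = (m - (\<Sum>c\<in>C. single c 1)) + (\<Sum>c\<in>C. single c 1)"
    using assms by (intro poly_mapping_eqI) (auto simp: lookup_add lookup_minus lk in_keys_iff simp del: One_nat_def)
  show "keys (m - (\<Sum>c\<in>C. single c 1)) \<subseteq> keys m"
    by (auto simp: in_keys_iff lookup_minus)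
qed

text \<open>Every term of a member is divisible by the product of a chain. With
  \<open>chain_ideal_ideal\<close> this shows that these products generate the ideal.\<close>

lemma chain_ideal_minimal:
  fixes J :: "(nat \<times> nat, 'a::comm_ring_1) mpoly set"
  assumes J: "ideal J (poly_ring (sv_vars d))"
    and C: "\<And>C. C \<subseteq> sv_vars d \<Longrightarrow> chain C \<Longrightarrow> card C = n \<Longrightarrow> single (\<Sum>c\<in>C. single c 1) 1 \<in> J"
  shows "chain_ideal d n \<subseteq> J"
proof
  fix p :: "(nat \<times> nat, 'a) mpoly"
  assume p: "p \<in> chain_ideal d n"
  have "single m (lookup p m) \<in> J" if m: "m \<in> keys p" for m
  proof -
    have V: "keys m \<subseteq> sv_vars d" using p m by (auto simp: chain_ideal_def polys_iff)
    obtain C where C': "C \<subseteq> keys m" "chain C" "card C = n"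
      using p m unfolding chain_ideal_def by blast
    obtain \<delta> where \<delta>: "m = \<delta> + (\<Sum>c\<in>C. single c 1)" "keys \<delta> \<subseteq> keys m"
      using monomial_divide[OF C'(1)] .
    have "single \<delta> (lookup p m) * single (\<Sum>c\<in>C. single c 1) 1 \<in> J"
      using C' \<delta>(2) V by (intro ideal_mult[OF J] C polys_single) auto
    from this[unfolded mult_single, folded \<delta>(1)] show ?thesis by simp
  qed
  then have "(\<Sum>m\<in>keys p. single m (lookup p m)) \<in> J" by (rule ideal_sum[OF J])
  then show "p \<in> J" by (simp flip: sum_single_lookup)
qed

lemma initial_monomial_chain_minor:
  assumes "diagonal_term_order TYPE('a::comm_ring_1) d ord" "C \<subseteq> sv_vars d" "chain C"
  shows "initial_monomial ord (det (submatrix (block_hankel d (d div 2)) (hrow ` C) (hcol ` C))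
      :: (nat \<times> nat, 'a) mpoly) = single (\<Sum>c\<in>C. single c 1) 1"
proof -
  have "initial_monomial ord (det (submatrix (block_hankel d (d div 2)) (hrow ` C) (hcol ` C))
      :: (nat \<times> nat, 'a) mpoly)
    = prod_list (diag_mat (submatrix (block_hankel d (d div 2)) (hrow ` C) (hcol ` C)))"
    using assms(1) chain_minor(1-4)[OF assms(2,3)] unfolding diagonal_term_order_def Let_def by simp
  then show ?thesis unfolding diagonal_chain_minor[OF assms(2,3)] .
qed

text \<open>Both the initial ideal of a secant ideal and the ideal of the leading monomials of the minors
  are squeezed between \<open>chain_ideal\<close> and itself.\<close>

lemma initial_ideals:
  fixes ord :: "(nat \<times> nat) monomial rel" and d r :: nat
  defines "M \<equiv> minors (r + 1) (block_hankel d (d div 2)) :: (nat \<times> nat, 'a::comm_ring_1) mpoly set"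
  assumes diag: "diagonal_term_order TYPE('a) d ord"
  shows "initial_ideal (sv_vars d) ord (secant_kernel d r :: (nat \<times> nat, 'a) mpoly set)
      = chain_ideal d (r + 1)"
    and "Idl\<^bsub>poly_ring (sv_vars d)\<^esub> {initial_monomial ord g | g. g \<in> M \<and> g \<noteq> 0} = chain_ideal d (r + 1)"
proof -
  let ?V = "sv_vars d"
  let ?K = "secant_kernel d r :: (nat \<times> nat, 'a) mpoly set"
  let ?inK = "{initial_monomial ord p | p. p \<in> ?K \<and> p \<noteq> 0}"
  let ?inM = "{initial_monomial ord p | p. p \<in> M \<and> p \<noteq> 0}"
  have ord: "term_order ?V ord"
    using diag by (simp add: diagonal_term_order_def)
  have "initial_monomial ord p \<in> chain_ideal d (r + 1)" if p: "p \<in> ?K" "p \<noteq> 0" for p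
  proof -
    have pV: "p \<in> polys ?V" using p(1) secant_kernel_polys by blast
    obtain m where m: "m \<in> keys p" "\<And>n. n \<in> keys p \<Longrightarrow> (n, m) \<in> ord"
      "initial_monomial ord p = single m 1"
      using initial_monomial[OF ord pV p(2)] by metis
    from leading_monomial_chain[OF diag p(1) m(1,2)]
    obtain C where "C \<subseteq> keys m" "chain C" "card C = Suc r" by blast
    then show ?thesis
      using m(1) pV unfolding m(3) by (auto simp: chain_ideal_def polys_iff)
  qed
  then have K: "?inK \<subseteq> chain_ideal d (r + 1)" by blast
  have "M \<subseteq> ?K" unfolding M_def by (rule minors_in_secant_kernel) simp
  then have MK: "?inM \<subseteq> ?inK" by blast
  have inK_V: "?inK \<subseteq> polys ?V" and inM_V: "?inM \<subseteq> polys ?V"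
    using K MK chain_ideal_polys by blast+
  have 1: "Idl\<^bsub>poly_ring ?V\<^esub> ?inK \<subseteq> chain_ideal d (r + 1)"
    by (rule Idl_minimal[OF chain_ideal_ideal K])
  have 2: "Idl\<^bsub>poly_ring ?V\<^esub> ?inM \<subseteq> Idl\<^bsub>poly_ring ?V\<^esub> ?inK"
    using MK Idl_self[OF inK_V] by (intro Idl_minimal[OF Idl_ideal[OF inK_V]]) blast
  have 3: "chain_ideal d (r + 1) \<subseteq> Idl\<^bsub>poly_ring ?V\<^esub> ?inM"
  proof (rule chain_ideal_minimal[OF Idl_ideal[OF inM_V]])
    fix C assume C: "C \<subseteq> ?V" "chain C" "card C = r + 1"
    let ?D = "det (submatrix (block_hankel d (d div 2)) (hrow ` C) (hcol ` C)) :: (nat \<times> nat, 'a) mpoly"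
    have "\<exists>R S. ?D = det (submatrix (block_hankel d (d div 2)) R S)
        \<and> R \<subseteq> {..<2 * (d div 2 + 1)} \<and> S \<subseteq> {..<2 * (d - d div 2 + 1)} \<and> card R = r + 1 \<and> card S = r + 1"
      using chain_minor(1-4)[OF C(1,2)] C(3)
      by (intro exI[of _ "hrow ` C"] exI[of _ "hcol ` C"]) simp
    then have "?D \<in> M" unfolding M_def minors_def by simp
    moreover have "?D \<noteq> 0" by (rule chain_minor_nonzero[OF C(1,2)])
    ultimately have "initial_monomial ord ?D \<in> ?inM" by blast
    then show "single (\<Sum>c\<in>C. single c 1) 1 \<in> Idl\<^bsub>poly_ring ?V\<^esub> ?inM"
      unfolding initial_monomial_chain_minor[OF diag C(1,2)] by (rule Idl_self[OF inM_V])
  qed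
  show "initial_ideal ?V ord ?K = chain_ideal d (r + 1)"
    unfolding initial_ideal_def using 1 2 3 by blast
  show "Idl\<^bsub>poly_ring ?V\<^esub> ?inM = chain_ideal d (r + 1)"
    using 1 2 3 by blast
qed

section \<open>Joins of chain ideals\<close>

lemma meval_restrict:
  "meval (\<lambda>v. if v \<in> S then Var v else 0) m
    = (if keys m \<subseteq> S then single m 1 else (0 :: ('v, 'a::comm_ring_1) mpoly))"
proof (cases "keys m \<subseteq> S")
  case True
  then have "meval (\<lambda>v. if v \<in> S then Var v else 0) m = (meval Var m :: ('v, 'a) mpoly)"
    by (intro meval_cong) auto
  with True show ?thesis by simp
next
  case False
  then obtain v where "v \<in> keys m" "v \<notin> S" by blast
  then have "\<exists>v\<in>keys m. (if v \<in> S then Var v else 0 :: ('v, 'a) mpoly) ^ lookup m v = 0"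
    by (intro bexI[of _ v]) (auto simp: in_keys_iff power_0_left)
  then have "meval (\<lambda>v. if v \<in> S then Var v else 0) m = (0 :: ('v, 'a) mpoly)"
    unfolding meval_def by (intro prod_zero) simp_all
  with False show ?thesis by simp
qed

text \<open>Setting the indeterminates outside \<open>S\<close> to zero leaves the monomials
  supported in \<open>S\<close> unchanged, so no cancellation can occur.\<close>

lemma subst_restrict_eq_0_iff:
  fixes p :: "('v, 'a::comm_ring_1) mpoly"
  shows "poly_subst Const (\<lambda>v. if v \<in> S then Var v else 0 :: ('v, 'a) mpoly) p = 0
    \<longleftrightarrow> (\<forall>m\<in>keys p. \<not> keys m \<subseteq> S)"
proof -
  have ps: "poly_subst Const (\<lambda>v. if v \<in> S then Var v else 0) p
      = (\<Sum>m\<in>keys p. if keys m \<subseteq> S then single m (lookup p m) else 0)"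
    unfolding poly_subst_def meval_def[symmetric] meval_restrict
    by (intro sum.cong) (simp_all add: Const_mult_single)
  show ?thesis
  proof
    assume 0: "poly_subst Const (\<lambda>v. if v \<in> S then Var v else 0 :: ('v, 'a) mpoly) p = 0"
    show "\<forall>m\<in>keys p. \<not> keys m \<subseteq> S"
    proof (intro ballI notI)
      fix m assume m: "m \<in> keys p" "keys m \<subseteq> S"
      have "0 = lookup (\<Sum>m\<in>keys p. if keys m \<subseteq> S then single m (lookup p m) else 0) m"
        using 0 unfolding ps by simp
      also have "\<dots> = (\<Sum>n\<in>keys p. if n = m then lookup p m else 0)"
        unfolding lookup_sum using m(2) by (intro sum.cong) (auto simp: lookup_single when_def)
      also have "\<dots> = lookup p m" using m(1) by simp
      finally show False using m(1) by (simp add: in_keys_iff)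
    qed
  qed (auto simp: ps intro: sum.neutral)
qed

text \<open>One inclusion splits a support without long chains into its minimal elements and the
  rest; the other expands a product of sums y + z over a chain and uses the pigeonhole
  principle.\<close>

lemma join_chain_ideal:
  "join_ideal (sv_vars d) (chain_ideal d 2) (chain_ideal d (Suc n))
    = (chain_ideal d (Suc (Suc n)) :: (nat \<times> nat, 'a::comm_ring_1) mpoly set)"
proof
  let ?V = "sv_vars d"
  show "join_ideal ?V (chain_ideal d 2) (chain_ideal d (Suc n))
      \<subseteq> (chain_ideal d (Suc (Suc n)) :: (nat \<times> nat, 'a) mpoly set)"
  proof
    fix p :: "(nat \<times> nat, 'a) mpoly"
    assume p: "p \<in> join_ideal ?V (chain_ideal d 2) (chain_ideal d (Suc n))"
    then have pV: "p \<in> polys ?V" by (simp add: join_ideal_def)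
    have "\<exists>C\<subseteq>keys m. chain C \<and> card C = Suc (Suc n)" if m: "m \<in> keys p" for m
    proof (rule ccontr)
      assume "\<not> ?thesis"
      then have "\<And>C. C \<subseteq> keys m \<Longrightarrow> chain C \<Longrightarrow> card C \<noteq> Suc (Suc n)" by blast
      from chain_split_minimal[OF finite_keys this] obtain F where
        F: "F \<subseteq> keys m" "\<And>v w. v \<in> F \<Longrightarrow> w \<in> F \<Longrightarrow> \<not> below v w"
        "\<And>C. C \<subseteq> keys m - F \<Longrightarrow> chain C \<Longrightarrow> card C = Suc n \<Longrightarrow> Suc n = 0" by blast
      \<comment> \<open>The y-copy survives on the antichain \<open>F\<close> and the z-copy on the
        rest, where no chain of \<open>Suc n\<close> elements is left. Both ideals are killed, but
        the monomial \<open>m\<close> is not.\<close>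
      define \<sigma> :: "(nat \<times> nat) copy \<Rightarrow> (nat \<times> nat, 'a) mpoly" where
        "\<sigma> x = (case x of CX v \<Rightarrow> if v \<in> keys m then Var v else 0
          | CY v \<Rightarrow> if v \<in> F then Var v else 0
          | CZ v \<Rightarrow> if v \<in> keys m - F then Var v else 0)" for x
      have "poly_subst Const (\<lambda>v. \<sigma> (CX v)) p = 0"
      proof (rule join_vanish[OF p])
        fix q :: "(nat \<times> nat, 'a) mpoly"
        show "poly_subst Const (\<lambda>v. \<sigma> (CY v)) q = 0" if q: "q \<in> chain_ideal d 2"
        proof -
          have "\<not> keys k \<subseteq> F" if k: "k \<in> keys q" for k
          proof
            assume "keys k \<subseteq> F"
            moreover obtain C where C: "C \<subseteq> keys k" "chain C" "card C = 2"
              using q k unfolding chain_ideal_def by blast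
            ultimately have "C \<subseteq> F" by blast
            from C(3) obtain v w where vw: "C = {v, w}" "v \<noteq> w" unfolding card_2_iff by blast
            then have "below v w \<or> below w v" using C(2) by (simp add: chain_def)
            with F(2)[of v w] F(2)[of w v] vw(1) \<open>C \<subseteq> F\<close> show False by blast
          qed
          then show ?thesis unfolding \<sigma>_def copy.case subst_restrict_eq_0_iff by blast
        qed
        show "poly_subst Const (\<lambda>v. \<sigma> (CZ v)) q = 0" if q: "q \<in> chain_ideal d (Suc n)"
        proof -
          have "\<not> keys k \<subseteq> keys m - F" if k: "k \<in> keys q" for k
          proof
            assume "keys k \<subseteq> keys m - F"
            moreover obtain C where C: "C \<subseteq> keys k" "chain C" "card C = Suc n"
              using q k unfolding chain_ideal_def by blast
            ultimately have "Suc n = 0" by (intro F(3)[of C]) auto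
            then show False by simp
          qed
          then show ?thesis unfolding \<sigma>_def copy.case subst_restrict_eq_0_iff by blast
        qed
        show "\<sigma> (CX v) = \<sigma> (CY v) + \<sigma> (CZ v)" for v
          using F(1) by (auto simp: \<sigma>_def)
      qed (rule chain_ideal_polys)+
      then show False unfolding \<sigma>_def copy.case subst_restrict_eq_0_iff using m by blast
    qed
    with pV show "p \<in> chain_ideal d (Suc (Suc n))" by (simp add: chain_ideal_def)
  qed
  show "chain_ideal d (Suc (Suc n))
      \<subseteq> (join_ideal ?V (chain_ideal d 2) (chain_ideal d (Suc n)) :: (nat \<times> nat, 'a) mpoly set)"
  proof
    fix p :: "(nat \<times> nat, 'a) mpoly"
    assume p: "p \<in> chain_ideal d (Suc (Suc n))"
    define W where "W = CX ` ?V \<union> CY ` ?V \<union> CZ ` ?V"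
    define gens :: "((nat \<times> nat) copy, 'a) mpoly set" where
      "gens = rename CY ` chain_ideal d 2 \<union> rename CZ ` chain_ideal d (Suc n)
        \<union> {Var (CX a) - Var (CY a) - Var (CZ a) | a. a \<in> ?V}"
    define A where "A = Idl\<^bsub>poly_ring W\<^esub> gens"
    have G: "gens \<subseteq> polys W"
      unfolding gens_def W_def by (rule join_generators_polys[OF chain_ideal_polys chain_ideal_polys])
    have A: "ideal A (poly_ring W)"
      unfolding A_def using G by (rule Idl_ideal)
    have Y: "rename CY q \<in> A" if "q \<in> chain_ideal d 2" for q
      unfolding A_def by (rule Idl_self[OF G]) (use that in \<open>simp add: gens_def\<close>)
    have Z: "rename CZ q \<in> A" if "q \<in> chain_ideal d (Suc n)" for q
      unfolding A_def by (rule Idl_self[OF G]) (use that in \<open>simp add: gens_def\<close>)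
    let ?s = "\<lambda>v. Var (CY v) + Var (CZ v) :: ((nat \<times> nat) copy, 'a) mpoly"
    \<comment> \<open>The preimage of \<open>A\<close> under x -> y + z is an ideal, so only the
      products of chains have to be checked.\<close>
    have "{q \<in> polys ?V. poly_subst Const ?s q \<in> A} \<supseteq> chain_ideal d (Suc (Suc n))"
    proof (rule chain_ideal_minimal)
      show "ideal {q \<in> polys ?V. poly_subst Const ?s q \<in> A} (poly_ring ?V)"
      proof (rule poly_idealI)
        fix a b :: "(nat \<times> nat, 'a) mpoly"
        assume a: "a \<in> {q \<in> polys ?V. poly_subst Const ?s q \<in> A}"
        show "a + b \<in> {q \<in> polys ?V. poly_subst Const ?s q \<in> A}"
          if "b \<in> {q \<in> polys ?V. poly_subst Const ?s q \<in> A}"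
          using a that by (auto simp: subst_Const.ps_add intro: polys_add ideal_add[OF A])
        show "b * a \<in> {q \<in> polys ?V. poly_subst Const ?s q \<in> A}" if b: "b \<in> polys ?V"
        proof -
          have "poly_subst Const ?s b \<in> polys W"
            using b by (rule polys_subst) (auto intro!: polys_add polys_Var simp: W_def)
          with a b show ?thesis by (auto simp: subst_Const.ps_mult intro: polys_mult ideal_mult[OF A])
        qed
      qed (auto simp: ideal_0[OF A])
    next
      fix C assume C: "C \<subseteq> ?V" "chain C" "card C = Suc (Suc n)"
      have fin: "finite C" using C(1) finite_sv_vars by (rule finite_subset)
      have keys_C: "keys (\<Sum>c\<in>B. single c (1::nat)) = B" if "B \<subseteq> C" for B
      proof -
        have "finite B" using that fin by (rule finite_subset)
        then show ?thesis
          by (auto simp: in_keys_iff lookup_sum lookup_single when_def split: if_splits)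
      qed
      have mono: "single (\<Sum>c\<in>B. single c 1) (1::'a) \<in> chain_ideal d k"
        if B: "B \<subseteq> C" "k \<le> card B" for B k
      proof -
        obtain D where D: "D \<subseteq> B" "card D = k" using B(2) by (rule obtain_subset_with_card_n)
        with B(1) C(2) have "chain D" by (meson chain_subset order_trans)
        moreover have "B \<subseteq> ?V" using B(1) C(1) by (rule order_trans)
        ultimately show ?thesis
          using D by (auto simp: chain_ideal_def keys_C[OF B(1)] polys_single simp del: One_nat_def)
      qed
      \<comment> \<open>Of the n + 2 elements of the chain, either two carry a y or at least n + 1
        carry a z.\<close>
      have term_mem: "(\<Prod>c\<in>B. Var (CY c)) * (\<Prod>c\<in>C - B. Var (CZ c)) \<in> A" if B: "B \<subseteq> C" for B
      proof -
        have y: "(\<Prod>c\<in>B. Var (CY c)) = rename CY (single (\<Sum>c\<in>B. single c 1) (1::'a))"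
          and z: "(\<Prod>c\<in>C - B. Var (CZ c)) = rename CZ (single (\<Sum>c\<in>C - B. single c 1) (1::'a))"
          by (simp_all add: rename_subst meval_sum)
        have yW: "(\<Prod>c\<in>B. Var (CY c)) \<in> (polys W :: ((nat \<times> nat) copy, 'a) mpoly set)"
          and zW: "(\<Prod>c\<in>C - B. Var (CZ c)) \<in> (polys W :: ((nat \<times> nat) copy, 'a) mpoly set)"
          using B C(1) by (auto intro!: polys_prod polys_Var simp: W_def)
        have finB: "finite B" using B fin by (rule finite_subset)
        show ?thesis
        proof (cases "2 \<le> card B")
          case True
          have "(\<Prod>c\<in>C - B. Var (CZ c)) * rename CY (single (\<Sum>c\<in>B. single c 1) (1::'a)) \<in> A"
            by (intro ideal_mult[OF A] Y mono B True zW)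
          then show ?thesis by (simp only: y mult.commute)
        next
          case False
          have "card (C - B) = card C - card B" using finB B by (rule card_Diff_subset)
          then have "Suc n \<le> card (C - B)" using False C(3) by linarith
          then have "(\<Prod>c\<in>B. Var (CY c)) * rename CZ (single (\<Sum>c\<in>C - B. single c 1) (1::'a)) \<in> A"
            by (intro ideal_mult[OF A] Z mono yW) auto
          then show ?thesis by (simp only: z)
        qed
      qed
      have "poly_subst Const ?s (single (\<Sum>c\<in>C. single c 1) 1) = (\<Prod>c\<in>C. Var (CY c) + Var (CZ c))"
        by (simp add: meval_sum)
      also have "\<dots> = (\<Sum>B\<in>Pow C. (\<Prod>c\<in>B. Var (CY c)) * (\<Prod>c\<in>C - B. Var (CZ c)))"
        by (rule prod_add[OF fin])
      also have "\<dots> \<in> A" using term_mem by (intro ideal_sum[OF A]) auto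
      finally have "poly_subst Const ?s (single (\<Sum>c\<in>C. single c 1) 1) \<in> A" .
      moreover have "single (\<Sum>c\<in>C. single c 1) (1::'a) \<in> polys ?V"
        using C(1) by (intro polys_single) (simp add: keys_C del: One_nat_def)
      ultimately show "single (\<Sum>c\<in>C. single c 1) 1 \<in> {q \<in> polys ?V. poly_subst Const ?s q \<in> A}"
        by blast
    qed
    with p have "poly_subst Const ?s p \<in> A" by blast
    then show "p \<in> join_ideal ?V (chain_ideal d 2) (chain_ideal d (Suc n))"
      using p chain_ideal_polys unfolding A_def W_def gens_def
      by (intro join_memberI[OF _ chain_ideal_polys chain_ideal_polys refl]) blast+
  qed
qed

lemma secant_chain_ideal:
  assumes "1 \<le> r"
  shows "secant_ideal (sv_vars d) r (chain_ideal d 2)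
    = (chain_ideal d (r + 1) :: (nat \<times> nat, 'a::comm_ring_1) mpoly set)"
  using assms
proof (induction r rule: nat_induct_at_least)
  case base
  show ?case by (simp add: secant_ideal_def numeral_2_eq_2)
next
  case (Suc r)
  then show ?case by (simp add: secant_ideal_Suc join_chain_ideal)
qed

lemma finite_minors: "finite (minors n M)"
proof -
  have "minors n M \<subseteq> (\<lambda>(R, C). det (submatrix M R C)) ` (Pow {..<dim_row M} \<times> Pow {..<dim_col M})"
    by (auto simp: minors_def)
  then show ?thesis by (rule finite_subset) simp
qed

theorem theorem6p6:
  fixes d :: nat and I :: "(nat \<times> nat, 'a::alg_closed_field) mpoly set"
  assumes "d \<ge> 1"
    and "I = sv_ideal d"
  shows "(\<forall>ord. diagonal_term_order TYPE('a) d ord \<longrightarrow> delightful (sv_vars d) ord I) \<and>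
    (primeideal I (poly_ring (sv_vars d)) \<and>
      I = vanishing_ideal (sv_vars d) (segre_veronese d) \<and>
      I = toric_ideal d) \<and>
    (\<forall>ord. diagonal_term_order TYPE('a) d ord \<longrightarrow>
      (\<forall>r\<ge>1. groebner_basis (sv_vars d) ord
        (minors (r + 1) (block_hankel d (d div 2))) (secant_ideal (sv_vars d) r I)))"
proof (intro conjI allI impI)
  show "primeideal I (poly_ring (sv_vars d))"
    "I = vanishing_ideal (sv_vars d) (segre_veronese d)" "I = toric_ideal d"
    unfolding assms(2) by (rule sv_ideal_prime sv_ideal_eq_vanishing sv_ideal_eq_toric)+
next
  fix ord assume diag: "diagonal_term_order TYPE('a) d ord"
  have "initial_ideal (sv_vars d) ord I = chain_ideal d 2"
    unfolding assms(2) sv_ideal_eq_secant_kernel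
    using initial_ideals(1)[OF diag, of 1] by (simp add: numeral_2_eq_2)
  \<comment> \<open>Both sides of the required equation are
    \<open>chain_ideal d (r + 1)\<close>.\<close>
  then show "delightful (sv_vars d) ord I"
    unfolding delightful_def
    by (simp add: assms(2) secant_ideal_sv_ideal secant_chain_ideal initial_ideals(1)[OF diag])
next
  fix ord and r :: nat assume diag: "diagonal_term_order TYPE('a) d ord" and r: "1 \<le> r"
  have "minors (r + 1) (block_hankel d (d div 2)) \<subseteq> (secant_kernel d r :: (nat \<times> nat, 'a) mpoly set)"
    by (rule minors_in_secant_kernel) simp
  with r show "groebner_basis (sv_vars d) ord
      (minors (r + 1) (block_hankel d (d div 2))) (secant_ideal (sv_vars d) r I)"
    using initial_ideals[OF diag, of r]
    unfolding groebner_basis_def assms(2) by (simp add: secant_ideal_sv_ideal finite_minors)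
qed

end
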